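(* Let $\rho_S,\rho_C\in(0,1]$. The pair (FATS, FATS-SU) satisfies sample-level exact federated unlearning, and the pair (FATS, FATS-CU) satisfies client-level exact federated unlearning. Moreover, for $w$ sample-level unlearning requests, the probability of re-computation (i.e. that the unlearning algorithm re-invokes FATS) is at most $\rho_S\cdot w$, and for $w$ client-level unlearning requests, the probability of re-computation is at most $\rho_C\cdot w$.
   Context: **Setting.** There are $M$ clients; client $k\in[M]=\{1,\dots,M\}$ holds a local dataset $\mathcal D_k$ of $N$ data points from a data universe $\mathcal X$. $\Theta$ is the parameter space and $f(\theta;X)$ a pointwise loss, differentiable in $\theta$. For a set of clients $\mathcal C$, $\mathcal D(\mathcal C)$ denotes all data held by the clients in $\mathcal C$. $\Delta(\cdot,\cdot)$ is symmetric difference. A learning algorithm $\mathcal L$ maps the data to a random algorithmic state in $\Theta\times\mathcal S$ (output model together with internal state: all intermediate local and global models, sampled mini-batches, sampled client multisets). An unlearning algorithm $\mathcal U$ maps an algorithmic state and an unlearning request to a new algorithmic state. **Sample-level exact federated unlearning** of $(\mathcal L,\mathcal U)$: for all $\mathcal D(\mathcal C)\supset\mathcal D(\mathcal C)'$ with $|\Delta(\mathcal D(\mathcal C),\mathcal D(\mathcal C)')|=1$ and all measurable $\mathcal E\subseteq\Theta\times\mathcal S$, $\mathbb P(\mathcal L(\mathcal D(\mathcal C)')\in\mathcal E)=\mathbb P(\mathcal U(\mathcal L(\mathcal D(\mathcal C)),\Delta(\mathcal D(\mathcal C),\mathcal D(\mathcal C)'))\in\mathcal E)$. **Client-level exact federated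 unlearning**: for all $\mathcal C\supset\mathcal C'$ with $|\Delta(\mathcal C,\mathcal C')|=1$ and all measurable $\mathcal E\subseteq\Theta\times\mathcal S$, $\mathbb P(\mathcal L(\mathcal D(\mathcal C'))\in\mathcal E)=\mathbb P(\mathcal U(\mathcal L(\mathcal D(\mathcal C)),\Delta(\mathcal D(\mathcal C),\mathcal D(\mathcal C')))\in\mathcal E)$. For a sequence of $w$ requests the condition is required recursively for every request. **FATS$(t_0,T,E,\eta,\rho_S,\rho_C)$.** Parameters: start iteration $t_0$ ($t_0=1$ for initial training), horizon $T=R\cdot E$, local iteration number $E$, learning rate $\eta$. Put $K=\rho_C E M/T$ and $b=\rho_S N/(\rho_C E)$ (assumed to be positive integers), and $\mathcal I_E=\{sE+1: s=0,1,\dots,\lfloor (T-1)/E\rfloor\}$ (first iterations of communication rounds). The initial global model $\theta^{(0)}$ is fixed. If $t_0\notin\mathcal I_E$, the stored client multiset $\mathcal P^{(t_0)}$ of the current round and the stored local models of its clients (immediately preceding iteration $t_0$) are loaded. Then for $t=t_0,\dots,T$: (i) if $t\in\mathcal I_E$, the server samples a multiset $\mathcal P^{(t)}$ of $K$ clients uniformly with replacement from the available clients, and sends them the latest global model, so that $\theta_k^{(t-1)}=\theta^{(t-1)}$ for $k\in\mathcal P^{(t)}$; if $t\notin\mathcal I_E$, $\mathcal P^{(t)}$ is the multiset of the current round; (ii) each $k\in\mathcal P^{(t)}$ samples a mini-batch $\mathcal B_k^{(t)}$ of size $b$ from its local dataset uniformly without replacement and sets $\theta_k^{(t)}=\theta_k^{(t-1)}-\eta\frac1b\sum_{X\in\mathcal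 B_k^{(t)}}\nabla f(\theta_k^{(t-1)};X)$; (iii) if $t\bmod E=0$, the server sets $\theta^{(t)}=\frac1K\sum_{k\in\mathcal P^{(t)}}\theta_k^{(t)}$. All sampled multisets, mini-batches and models are saved; the output is $\theta^{(T)}$. All samplings are independent. When FATS is run after a deletion, sampling is from the remaining samples/clients while $K$ and $b$ keep the values computed from the original $M,N$. **FATS-SU$(t_u,X_u,k_u)$** (request at step $t_u$ to delete sample $X_u\in\mathcal D_{k_u}$): for $t=1,\dots,t_u$, check whether $k_u\in\mathcal P^{(t)}$ and $X_u\in\mathcal B_{k_u}^{(t)}$. At the first such $t$, called $t_S$, run FATS$(t_S,T,E,\eta,\rho_S,\rho_C)$ on the data without $X_u$ and halt (this is a re-computation). If there is no such $t$, the state is left unchanged (and, if $t_u<T$, training simply continues on the remaining data). **FATS-CU$(t_u,k_u)$** (request at step $t_u$ to delete client $k_u$): let $r_u=\lfloor (t_u-1)/E\rfloor+1$; for $r=1,\dots,r_u$ let $t_r=(r-1)E+1$ and check whether $k_u\in\mathcal P^{(t_r)}$. At the first such $r$, with $t_C=t_r$, run FATS$(t_C,T,E,\eta,\rho_S,\rho_C)$ without client $k_u$ and halt (a re-computation). Otherwise the state is left unchanged (and training, if unfinished, continues with the remaining clients).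
   Formalization: Sample-level exactness is proved for FATS-SU modified to keep the stored client multiset when t_S is the first iteration of a round; with the literal redraw of clients exactness fails (M=N=2, T=E=K=b=1: client 1 has probability 3/8, not 1/2). *)

theory Defs
  imports "HOL-Probability.Probability"
begin

section \<open>Federated data and exact federated unlearning\<close>

text \<open>
  The data \<open>\<D>(\<C>)\<close> held by a set of clients is the set of all pairs \<open>(k, X)\<close> with \<open>X\<close> in the local
  dataset of client \<open>k\<close>. So \<open>Domain D\<close> is the set of available clients, \<open>D `` {k}\<close> is the local
  dataset of client \<open>k\<close>, and the data of the clients \<open>C\<close> with local datasets \<open>\<D>\<close> is \<open>Sigma C \<D>\<close>.
  A client whose local dataset is empty would not be represented; \<open>trainable\<close> and the condition on
  \<open>Domain\<close> in \<open>sample_deletion\<close> make sure that this case does not arise.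
\<close>

type_synonym 'x fdata = "(nat \<times> 'x) set"

definition sample_deletion :: "'x fdata \<Rightarrow> 'x fdata \<Rightarrow> bool" where
  "sample_deletion D D' \<longleftrightarrow>
     D' \<subset> D \<and> Domain D' = Domain D \<and> card (sym_diff D D') = 1"

definition client_deletion :: "'x fdata \<Rightarrow> 'x fdata \<Rightarrow> bool" where
  "client_deletion D D' \<longleftrightarrow>
     (\<exists>C'. C' \<subset> Domain D \<and> card (sym_diff (Domain D) C') = 1 \<and> D' = {(k, X) \<in> D. k \<in> C'})"

text \<open>
  A sequence of unlearning requests is a list of pairs \<open>(t, D')\<close>: the request arrives at step \<open>t\<close> of a
  training of \<open>T\<close> steps, and \<open>D'\<close> is the data remaining after it. The set \<open>\<A>\<close> collects the data on
  which the learning algorithm can be run.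
\<close>

definition request_sequence ::
  "('x fdata \<Rightarrow> 'x fdata \<Rightarrow> bool) \<Rightarrow> 'x fdata set \<Rightarrow> nat \<Rightarrow> 'x fdata \<Rightarrow> (nat \<times> 'x fdata) list \<Rightarrow> bool"
where
  "request_sequence deletion \<A> T D rs \<longleftrightarrow>
     successively deletion (D # map snd rs) \<and> set (map snd rs) \<subseteq> \<A> \<and>
     sorted (map fst rs) \<and> set (map fst rs) \<subseteq> {1..T}"

definition remaining_data :: "'x fdata \<Rightarrow> (nat \<times> 'x fdata) list \<Rightarrow> 'x fdata" where
  "remaining_data D rs = last (D # map snd rs)"

text \<open>
  \<open>train D t s\<close> continues the training from state \<open>s\<close> on the data \<open>D\<close> until step \<open>t\<close> is completed (and
  does nothing if \<open>s\<close> is already that far); training from the initial state to the horizon \<open>T\<close> is the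
  learning algorithm. \<open>unlearn D' \<Delta> s\<close> processes the request \<open>\<Delta>\<close> in state \<open>s\<close>, where \<open>D'\<close> is the data
  left; its Boolean tells whether a re-computation took place. The function \<open>serve\<close> interleaves
  training and unlearning: it returns the state after the last request has been processed and the
  training has been completed on the remaining data, and whether any request led to a re-computation.
\<close>

fun serve ::
  "('x fdata \<Rightarrow> nat \<Rightarrow> 's \<Rightarrow> 's pmf) \<Rightarrow> ('x fdata \<Rightarrow> 'x fdata \<Rightarrow> 's \<Rightarrow> (bool \<times> 's) pmf) \<Rightarrow> nat \<Rightarrow>
   'x fdata \<Rightarrow> (nat \<times> 'x fdata) list \<Rightarrow> 's \<Rightarrow> (bool \<times> 's) pmf"
where
  "serve train unlearn T D [] s = map_pmf (Pair False) (train D T s)"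
| "serve train unlearn T D ((t, D') # rs) s = do {
     s1 \<leftarrow> train D t s;
     (c, s2) \<leftarrow> unlearn D' (sym_diff D D') s1;
     (c', s3) \<leftarrow> serve train unlearn T D' rs s2;
     return_pmf (c \<or> c', s3)
   }"

text \<open>
  All random choices are discrete, so every set of states is an event. Initial segments of a request
  sequence are request sequences, hence the condition is imposed after every single request; a single
  request at step \<open>T\<close> gives the condition for the fully trained state.
\<close>

definition exact_unlearning ::
  "('x fdata \<Rightarrow> 'x fdata \<Rightarrow> bool) \<Rightarrow> 'x fdata set \<Rightarrow> nat \<Rightarrow> 's \<Rightarrow>
   ('x fdata \<Rightarrow> nat \<Rightarrow> 's \<Rightarrow> 's pmf) \<Rightarrow> ('x fdata \<Rightarrow> 'x fdata \<Rightarrow> 's \<Rightarrow> (bool \<times> 's) pmf) \<Rightarrow> bool"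
where
  "exact_unlearning deletion \<A> T s0 train unlearn \<longleftrightarrow>
     (\<forall>D \<in> \<A>. \<forall>rs. request_sequence deletion \<A> T D rs \<longrightarrow>
        (\<forall>\<E>. measure_pmf.prob (train (remaining_data D rs) T s0) \<E> =
             measure_pmf.prob (map_pmf snd (serve train unlearn T D rs s0)) \<E>))"

abbreviation sample_level_exact_unlearning where
  "sample_level_exact_unlearning \<equiv> exact_unlearning sample_deletion"

abbreviation client_level_exact_unlearning where
  "client_level_exact_unlearning \<equiv> exact_unlearning client_deletion"

definition recomputation_prob ::
  "nat \<Rightarrow> 's \<Rightarrow> ('x fdata \<Rightarrow> nat \<Rightarrow> 's \<Rightarrow> 's pmf) \<Rightarrow>
   ('x fdata \<Rightarrow> 'x fdata \<Rightarrow> 's \<Rightarrow> (bool \<times> 's) pmf) \<Rightarrow> 'x fdata \<Rightarrow> (nat \<times> 'x fdata) list \<Rightarrow> real"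
where
  "recomputation_prob T s0 train unlearn D rs =
     measure_pmf.prob (serve train unlearn T D rs s0) {(c, s). c}"


section \<open>FATS\<close>

record ('p, 'x) fats_params =
  loss :: "'p \<Rightarrow> 'x \<Rightarrow> real"
  init_model :: 'p
  horizon :: nat
  local_iters :: nat
  learning_rate :: real
  cohort_size :: nat
  batch_size :: nat

record ('p, 'x) iteration =
  clients :: "nat multiset"
  batch :: "nat \<Rightarrow> 'x set"
  local_model :: "nat \<Rightarrow> 'p"
  global_model :: 'p

text \<open>
  A state consists of the latest global model and the list of the saved iterations: the entry at
  position \<open>t - 1\<close> belongs to iteration \<open>t\<close>. In an iteration that does not end a round,
  \<open>global_model\<close> is the global model at the beginning of the round.
\<close>

type_synonym ('p, 'x) fats_state = "'p \<times> ('p, 'x) iteration list"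

definition init_state :: "('p, 'x) fats_params \<Rightarrow> ('p, 'x) fats_state" where
  "init_state p = (init_model p, [])"

definition round_starts :: "('p, 'x) fats_params \<Rightarrow> nat set" where
  "round_starts p = {s * local_iters p + 1 |s. s \<le> (horizon p - 1) div local_iters p}"

definition loss_gradient :: "('p::real_inner, 'x) fats_params \<Rightarrow> 'p \<Rightarrow> 'x \<Rightarrow> 'p" where
  "loss_gradient p \<theta> X = (THE g. GDERIV (\<lambda>\<theta>'. loss p \<theta>' X) \<theta> :> g)"

text \<open>Data on which mini-batches of the prescribed size can be drawn without replacement.\<close>

definition trainable :: "('p, 'x) fats_params \<Rightarrow> 'x fdata set" where
  "trainable p = {D. finite D \<and> D \<noteq> {} \<and> (\<forall>k\<in>Domain D. batch_size p \<le> card (D `` {k}))}"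

definition sample_clients :: "('p, 'x) fats_params \<Rightarrow> 'x fdata \<Rightarrow> nat multiset pmf" where
  "sample_clients p D = map_pmf mset (replicate_pmf (cohort_size p) (pmf_of_set (Domain D)))"

definition sample_batches ::
  "('p, 'x) fats_params \<Rightarrow> 'x fdata \<Rightarrow> nat multiset \<Rightarrow> (nat \<Rightarrow> 'x set) pmf" where
  "sample_batches p D P =
     Pi_pmf (set_mset P) {} (\<lambda>k. pmf_of_set {B. B \<subseteq> D `` {k} \<and> card B = batch_size p})"

text \<open>The deterministic part of an iteration; entries of clients outside \<open>P\<close> are set to \<open>0\<close>.\<close>

definition update ::
  "('p::real_inner, 'x) fats_params \<Rightarrow> nat multiset \<Rightarrow> (nat \<Rightarrow> 'x set) \<Rightarrow>
   ('p, 'x) fats_state \<Rightarrow> ('p, 'x) fats_state"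
where
  "update p P B = (\<lambda>(\<theta>, h).
     let t = length h + 1;
         prev = (\<lambda>k. if t \<in> round_starts p then \<theta> else local_model (last h) k);
         new = (\<lambda>k. if k \<in># P
                    then prev k - (learning_rate p / real (batch_size p)) *\<^sub>R
                                  (\<Sum>X\<in>B k. loss_gradient p (prev k) X)
                    else 0);
         \<theta>' = (if t mod local_iters p = 0
               then (1 / real (cohort_size p)) *\<^sub>R (\<Sum>k\<in>#P. new k) else \<theta>)
     in (\<theta>', h @ [\<lparr>clients = P, batch = B, local_model = new, global_model = \<theta>'\<rparr>]))"

definition iterate_with ::
  "('p::real_inner, 'x) fats_params \<Rightarrow> 'x fdata \<Rightarrow> nat multiset \<Rightarrow>
   ('p, 'x) fats_state \<Rightarrow> ('p, 'x) fats_state pmf"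
where
  "iterate_with p D P st = map_pmf (\<lambda>B. update p P B st) (sample_batches p D P)"

definition iterate ::
  "('p::real_inner, 'x) fats_params \<Rightarrow> 'x fdata \<Rightarrow> ('p, 'x) fats_state \<Rightarrow> ('p, 'x) fats_state pmf"
where
  "iterate p D st = do {
     P \<leftarrow> (if length (snd st) + 1 \<in> round_starts p then sample_clients p D
          else return_pmf (clients (last (snd st))));
     iterate_with p D P st
   }"

definition fats_train ::
  "('p::real_inner, 'x) fats_params \<Rightarrow> 'x fdata \<Rightarrow> nat \<Rightarrow> ('p, 'x) fats_state \<Rightarrow> ('p, 'x) fats_state pmf"
where
  "fats_train p D t st = ((\<lambda>\<mu>. bind_pmf \<mu> (iterate p D)) ^^ (t - length (snd st))) (return_pmf st)"

definition rewind ::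
  "('p, 'x) fats_params \<Rightarrow> nat \<Rightarrow> ('p, 'x) fats_state \<Rightarrow> ('p, 'x) fats_state" where
  "rewind p t st =
     (if t = 1 then init_model p else global_model (snd st ! (t - 2)), take (t - 1) (snd st))"

text \<open>
  FATS started at iteration \<open>t\<^sub>0\<close> with the quantities stored in \<open>st\<close>. Initial training, \<open>t\<^sub>0 = 1\<close>, is
  \<open>fats_train p D (horizon p) (init_state p)\<close>.
\<close>

definition fats ::
  "('p::real_inner, 'x) fats_params \<Rightarrow> 'x fdata \<Rightarrow> nat \<Rightarrow> ('p, 'x) fats_state \<Rightarrow> ('p, 'x) fats_state pmf"
where
  "fats p D t\<^sub>0 st = fats_train p D (horizon p) (rewind p t\<^sub>0 st)"

text \<open>
  The same, but with the stored client multiset of iteration \<open>t\<^sub>0\<close> loaded in every case, i.e.\ also if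
  \<open>t\<^sub>0\<close> is the first iteration of a round. For all other \<open>t\<^sub>0\<close> this agrees with \<^const>\<open>fats\<close>.
\<close>

definition fats_reload ::
  "('p::real_inner, 'x) fats_params \<Rightarrow> 'x fdata \<Rightarrow> nat \<Rightarrow> ('p, 'x) fats_state \<Rightarrow> ('p, 'x) fats_state pmf"
where
  "fats_reload p D t\<^sub>0 st =
     bind_pmf (iterate_with p D (clients (snd st ! (t\<^sub>0 - 1))) (rewind p t\<^sub>0 st))
       (fats_train p D (horizon p))"


section \<open>Unlearning\<close>

definition fats_su_with ::
  "('x fdata \<Rightarrow> nat \<Rightarrow> ('p, 'x) fats_state \<Rightarrow> ('p, 'x) fats_state pmf) \<Rightarrow>
   'x fdata \<Rightarrow> nat \<Rightarrow> 'x \<Rightarrow> nat \<Rightarrow> ('p, 'x) fats_state \<Rightarrow> (bool \<times> ('p, 'x) fats_state) pmf"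
where
  "fats_su_with restart D' t\<^sub>u X\<^sub>u k\<^sub>u st =
     (case find (\<lambda>t. k\<^sub>u \<in># clients (snd st ! (t - 1)) \<and> X\<^sub>u \<in> batch (snd st ! (t - 1)) k\<^sub>u)
             [1..<Suc t\<^sub>u] of
        None \<Rightarrow> return_pmf (False, st)
      | Some t\<^sub>S \<Rightarrow> map_pmf (Pair True) (restart D' t\<^sub>S st))"

definition fats_cu ::
  "('p::real_inner, 'x) fats_params \<Rightarrow>
   'x fdata \<Rightarrow> nat \<Rightarrow> nat \<Rightarrow> ('p, 'x) fats_state \<Rightarrow> (bool \<times> ('p, 'x) fats_state) pmf"
where
  "fats_cu p D' t\<^sub>u k\<^sub>u st =
     (let t = (\<lambda>r. (r - 1) * local_iters p + 1);
          r\<^sub>u = (t\<^sub>u - 1) div local_iters p + 1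
      in case find (\<lambda>r. k\<^sub>u \<in># clients (snd st ! (t r - 1))) [1..<Suc r\<^sub>u] of
           None \<Rightarrow> return_pmf (False, st)
         | Some r \<Rightarrow> map_pmf (Pair True) (fats p D' (t r) st))"

text \<open>
  The unlearning algorithms as functions of the request \<open>\<Delta>\<close>. The request step \<open>t\<^sub>u\<close> is the last
  completed iteration of the current state. (After a re-computation this is the horizon, even if the
  next request was scheduled for an earlier step.)

  If a re-computation for a sample starts in the first iteration of a round, the clients of this
  round are kept in \<open>fats_su\<close>, while they are drawn afresh in \<open>fats_su_redraw\<close>. Redrawing destroys
  exactness: the event that triggers the re-computation makes the presence of the client \<open>k\<^sub>u\<close> in
  this round more likely, so that \<open>k\<^sub>u\<close> would end up in the round with too small a probability.
\<close>

definition fats_su ::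
  "('p::real_inner, 'x) fats_params \<Rightarrow> 'x fdata \<Rightarrow> 'x fdata \<Rightarrow>
   ('p, 'x) fats_state \<Rightarrow> (bool \<times> ('p, 'x) fats_state) pmf"
where
  "fats_su p D' \<Delta> st =
     (let (k\<^sub>u, X\<^sub>u) = the_elem \<Delta> in fats_su_with (fats_reload p) D' (length (snd st)) X\<^sub>u k\<^sub>u st)"

definition fats_su_redraw ::
  "('p::real_inner, 'x) fats_params \<Rightarrow> 'x fdata \<Rightarrow> 'x fdata \<Rightarrow>
   ('p, 'x) fats_state \<Rightarrow> (bool \<times> ('p, 'x) fats_state) pmf"
where
  "fats_su_redraw p D' \<Delta> st =
     (let (k\<^sub>u, X\<^sub>u) = the_elem \<Delta> in fats_su_with (fats p) D' (length (snd st)) X\<^sub>u k\<^sub>u st)"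

definition fats_cu_request ::
  "('p::real_inner, 'x) fats_params \<Rightarrow> 'x fdata \<Rightarrow> 'x fdata \<Rightarrow>
   ('p, 'x) fats_state \<Rightarrow> (bool \<times> ('p, 'x) fats_state) pmf"
where
  "fats_cu_request p D' \<Delta> st = fats_cu p D' (length (snd st)) (the_elem (Domain \<Delta>)) st"

end

theory Submission
  imports Defs
begin

text \<open>
  Both algorithms rest on rejection sampling: drawing uniformly from a finite set and drawing once more
  from a subset whenever the first draw falls outside it yields the uniform distribution on the subset.
  For a sample this applies to the mini-batch of its client given the clients of the round, for a client
  to the client multiset of a round. Hence re-computing from the first iteration that involves the
  deleted item turns a run on the old data into a run on the remaining data (\<open>train_unlearned\<close>).

  It follows that a run on the remaining data satisfies a property at most as often as a run on the old
  data satisfies it or involves the deleted item. Iterating this, the probability of a re-computation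
  within a sequence of requests is at most the probability that a run on the \<^emph>\<open>original\<close> data
  involves any of the deleted items. A union bound over the requests made one after the other on the
  shrinking data would not suffice, since a mini-batch contains a given sample more often when fewer
  samples are left.
\<close>

section \<open>Resampling\<close>

lemma pmf_replicate_pmf:
  "pmf (replicate_pmf n q) xs = (if length xs = n then prod_list (map (pmf q) xs) else 0)"
proof (induction n arbitrary: xs)
  case 0
  show ?case by (auto simp: pmf_return)
next
  case (Suc n)
  \<comment> \<open>Written as the image of a product under consing, which is injective, so that
    point masses multiply.\<close>
  have eq: "replicate_pmf (Suc n) q = map_pmf (\<lambda>(x, ys). x # ys) (pair_pmf q (replicate_pmf n q))"
    by (simp add: map_pmf_def pair_pmf_def bind_assoc_pmf bind_return_pmf)
  show ?case
  proof (cases xs)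
    case Nil
    then show ?thesis by (auto simp: pmf_eq_0_set_pmf set_replicate_pmf simp del: replicate_pmf.simps)
  next
    case (Cons x ys)
    have "inj (\<lambda>(x, ys). x # ys :: 'a list)" by (auto simp: inj_def)
    from pmf_map_inj'[OF this, of "pair_pmf q (replicate_pmf n q)" "(x, ys)"]
    have "pmf (replicate_pmf (Suc n) q) xs = pmf (pair_pmf q (replicate_pmf n q)) (x, ys)"
      unfolding eq Cons by simp
    then show ?thesis by (simp add: pmf_pair Suc.IH Cons del: replicate_pmf.simps)
  qed
qed

lemma replicate_pmf_of_set:
  assumes "finite S" "S \<noteq> {}"
  shows "replicate_pmf n (pmf_of_set S) = pmf_of_set {xs. set xs \<subseteq> S \<and> length xs = n}"
proof (rule pmf_eqI)
  fix xs :: "'a list"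
  let ?L = "{xs. set xs \<subseteq> S \<and> length xs = n}"
  obtain a where "a \<in> S" using assms by auto
  then have "replicate n a \<in> ?L" by (auto simp: set_replicate_conv_if)
  then have L: "finite ?L" "?L \<noteq> {}"
    using finite_lists_length_eq[OF assms(1)] by blast+
  have "prod_list (map (pmf (pmf_of_set S)) xs) = (if set xs \<subseteq> S then 1 / real (card S) ^ length xs else 0)"
    by (induction xs) (auto simp: assms pmf_of_set)
  then show "pmf (replicate_pmf n (pmf_of_set S)) xs = pmf (pmf_of_set ?L) xs"
    using card_lists_length_eq[OF assms(1), of n]
    by (auto simp: pmf_replicate_pmf pmf_of_set[OF L(2,1)])
qed

text \<open>A point of \<open>T\<close> keeps mass 1 / card S from an accepted first draw and
  receives (card S - card T) / card S * (1 / card T) from the rejected ones; these add up to 1 /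
  card T.\<close>

lemma resample_pmf_of_set:
  assumes "finite S" "T \<subseteq> S" "T \<noteq> {}"
  shows "bind_pmf (pmf_of_set S) (\<lambda>x. if x \<in> T then return_pmf x else pmf_of_set T) = pmf_of_set T"
proof (rule pmf_eqI)
  fix y
  have S: "S \<noteq> {}" and T: "finite T" using assms finite_subset by auto
  have cS: "card S > 0" and cT: "card T > 0" using S T assms by (auto simp: card_gt_0_iff)
  have "pmf (bind_pmf (pmf_of_set S) (\<lambda>x. if x \<in> T then return_pmf x else pmf_of_set T)) y =
        (\<Sum>x\<in>S. pmf (if x \<in> T then return_pmf x else pmf_of_set T) y) / card S"
    by (simp add: pmf_bind integral_pmf_of_set S assms)
  also have "(\<Sum>x\<in>S. pmf (if x \<in> T then return_pmf x else pmf_of_set T) y) =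
     (\<Sum>x\<in>T. pmf (return_pmf x) y) + (\<Sum>x\<in>S - T. pmf (pmf_of_set T) y)"
    by (subst sum.subset_diff[OF assms(2,1)]) simp
  also have "(\<Sum>x\<in>T. pmf (return_pmf x) y) = indicator T y"
    using T by (simp add: pmf_return indicator_def)
  also have "(\<Sum>x\<in>S - T. pmf (pmf_of_set T) y) = (real (card S) - real (card T)) * (indicator T y / card T)"
    using assms T card_mono[OF assms(1,2)]
    by (simp add: card_Diff_subset of_nat_diff pmf_of_set)
  finally show "pmf (bind_pmf (pmf_of_set S) (\<lambda>x. if x \<in> T then return_pmf x else pmf_of_set T)) y =
      pmf (pmf_of_set T) y"
    using S cS cT T assms by (simp add: pmf_of_set field_simps)
qed

text \<open>The test looks at coordinate \<open>k\<close> only, and the other coordinates are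
  independent of it with the same law under \<open>q\<close> and \<open>q'\<close>. So redrawing the
  whole family after a failed test has the same law as redrawing coordinate \<open>k\<close> alone,
  to which the last assumption applies.\<close>

lemma resample_Pi_pmf:
  assumes "finite A" "k \<in> A" "\<And>x. x \<in> A \<Longrightarrow> x \<noteq> k \<Longrightarrow> q' x = q x"
    and "bind_pmf (q k) (\<lambda>y. if Q y then q' k else return_pmf y) = q' k"
  shows "bind_pmf (Pi_pmf A d q) (\<lambda>f. if Q (f k) then Pi_pmf A d q' else return_pmf f) = Pi_pmf A d q'"
proof -
  let ?F = "\<lambda>y. bind_pmf (Pi_pmf (A - {k}) d q) (\<lambda>f. return_pmf (f(k := y)))"
  have A: "insert k (A - {k}) = A" using assms by auto
  have Pq: "Pi_pmf A d q = bind_pmf (q k) ?F"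
    using Pi_pmf_insert'[of "A - {k}" k d q] assms(1) A by simp
  have "Pi_pmf (A - {k}) d q' = Pi_pmf (A - {k}) d q"
    using assms(3) by (intro Pi_pmf_cong) auto
  then have Pq': "Pi_pmf A d q' = bind_pmf (q' k) ?F"
    using Pi_pmf_insert'[of "A - {k}" k d q'] assms(1) A by simp
  have "bind_pmf (Pi_pmf A d q) (\<lambda>f. if Q (f k) then Pi_pmf A d q' else return_pmf f) =
      bind_pmf (q k) (\<lambda>y. if Q y then Pi_pmf A d q' else ?F y)"
    unfolding Pq by (auto simp: bind_assoc_pmf bind_return_pmf intro!: bind_pmf_cong)
  also have "\<dots> = bind_pmf (bind_pmf (q k) (\<lambda>y. if Q y then q' k else return_pmf y)) ?F"
    unfolding Pq' bind_assoc_pmf by (auto simp: bind_return_pmf intro!: bind_pmf_cong)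
  finally show ?thesis using assms(4) Pq' by simp
qed

section \<open>Probabilities of mixtures and of single uniform draws\<close>

lemma prob_bind_pmf:
  "measure_pmf.prob (bind_pmf M f) A = measure_pmf.expectation M (\<lambda>x. measure_pmf.prob (f x) A)"
proof -
  have "measure_pmf.expectation M (\<lambda>x. measure_pmf.prob (f x) A) =
      enn2real (\<integral>\<^sup>+x. ennreal (measure_pmf.prob (f x) A) \<partial>M)"
    by (rule integral_eq_nn_integral) auto
  also have "\<dots> = enn2real (emeasure (bind_pmf M f) A)"
    by (simp flip: measure_pmf.emeasure_eq_measure)
  finally show ?thesis by (simp add: measure_def[of "measure_pmf (bind_pmf M f)"])
qed

text \<open>Affine bounds survive averaging over the first stage. With \<open>g = return_pmf\<close>
  the right-hand side speaks of the state before the step; \<open>c = 0\<close> gives a constant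
  bound, \<open>c = 1\<close> and \<open>e = 0\<close> a plain comparison.\<close>

lemma prob_bind_pmf_le:
  assumes "\<And>x. x \<in> set_pmf M \<Longrightarrow>
      measure_pmf.prob (f x) A \<le> c * measure_pmf.prob (g x) B + e"
  shows "measure_pmf.prob (bind_pmf M f) A \<le> c * measure_pmf.prob (bind_pmf M g) B + e"
proof -
  have int: "integrable (measure_pmf M) (\<lambda>x. measure_pmf.prob (f x) A)"
    by (rule measure_pmf.integrable_const_bound[where B = 1]) auto
  have int': "integrable (measure_pmf M) (\<lambda>x. measure_pmf.prob (g x) B)"
    by (rule measure_pmf.integrable_const_bound[where B = 1]) auto
  have "measure_pmf.expectation M (\<lambda>x. measure_pmf.prob (f x) A) \<le>
      measure_pmf.expectation M (\<lambda>x. c * measure_pmf.prob (g x) B + e)"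
    using assms int int' by (intro integral_mono_AE) (auto simp: AE_measure_pmf_iff)
  also have "\<dots> = c * measure_pmf.expectation M (\<lambda>x. measure_pmf.prob (g x) B) + e"
    using int' by simp
  finally show ?thesis by (simp add: prob_bind_pmf)
qed

text \<open>A union bound over the draws, one of which is split off in each induction step.\<close>

lemma prob_replicate_pmf_mem_le:
  "measure_pmf.prob (replicate_pmf n q) {xs. k \<in> set xs} \<le> real n * pmf q k"
proof (induction n)
  case (Suc n)
  have eq: "replicate_pmf (Suc n) q = bind_pmf q (\<lambda>x. map_pmf ((#) x) (replicate_pmf n q))"
    by (simp add: map_pmf_def)
  have "measure_pmf.prob (replicate_pmf (Suc n) q) {xs. k \<in> set xs} \<le>
      1 * measure_pmf.prob (bind_pmf q return_pmf) {k} + real n * pmf q k"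
    unfolding eq
  proof (rule prob_bind_pmf_le)
    fix x
    have "(#) x -` {xs. k \<in> set xs} = (if x = k then UNIV else {xs. k \<in> set xs})" by auto
    then show "measure_pmf.prob (map_pmf ((#) x) (replicate_pmf n q)) {xs. k \<in> set xs} \<le>
        1 * measure_pmf.prob (return_pmf x) {k} + real n * pmf q k"
      using Suc by (auto simp: indicator_def)
  qed
  then show ?case by (simp add: bind_return_pmf' measure_pmf_single algebra_simps)
qed simp

text \<open>Removing \<open>a\<close> matches the favourable sets with the subsets of
  \<open>S - {a}\<close> of size \<open>b - 1\<close>; the quotient of the two binomial coefficients
  follows from the absorption identity.\<close>

lemma prob_subset_of_size_mem:
  assumes "finite S" "a \<in> S" "0 < b" "b \<le> card S"
  shows "measure_pmf.prob (pmf_of_set {B. B \<subseteq> S \<and> card B = b}) {B. a \<in> B} = real b / real (card S)"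
proof -
  let ?F = "{B. B \<subseteq> S \<and> card B = b}"
  have cF: "card ?F = card S choose b" using n_subsets[OF assms(1)] .
  have fin: "finite ?F" using assms(1) by simp
  have pos: "0 < card S choose b" using assms by simp
  have ne: "?F \<noteq> {}" using cF pos by (metis card.empty less_irrefl)
  have "?F \<inter> {B. a \<in> B} = insert a ` {B. B \<subseteq> S - {a} \<and> card B = b - 1}"
  proof (intro equalityI subsetI)
    fix B assume B: "B \<in> ?F \<inter> {B. a \<in> B}"
    then have "finite B" using assms(1) finite_subset by auto
    then have "B = insert a (B - {a})" "B - {a} \<subseteq> S - {a}" "card (B - {a}) = b - 1" using B by auto
    then show "B \<in> insert a ` {B. B \<subseteq> S - {a} \<and> card B = b - 1}" by blast
  next
    fix B assume "B \<in> insert a ` {B. B \<subseteq> S - {a} \<and> card B = b - 1}"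
    then obtain C where C: "B = insert a C" "C \<subseteq> S - {a}" "card C = b - 1" by auto
    then have "finite C" using assms(1) finite_subset by blast
    with C show "B \<in> ?F \<inter> {B. a \<in> B}" using assms by (subst C) (auto simp: card_insert_if)
  qed
  moreover have "inj_on (insert a) {B. B \<subseteq> S - {a} \<and> card B = b - 1}"
    by (auto simp: inj_on_def)
  ultimately have "card (?F \<inter> {B. a \<in> B}) = (card S - 1) choose (b - 1)"
    using n_subsets[of "S - {a}" "b - 1"] assms by (simp add: card_image)
  moreover have "b * (card S choose b) = card S * ((card S - 1) choose (b - 1))"
    using times_binomial_minus1_eq[OF assms(3)] .
  then have "real b * real (card S choose b) = real (card S) * real ((card S - 1) choose (b - 1))"
    by (metis of_nat_mult)
  ultimately show ?thesis
    using fin pos cF assms(3,4)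
    by (subst measure_pmf_of_set[OF ne fin]) (auto simp: field_simps)
qed

section \<open>Training\<close>

text \<open>Under the invariant below a state is a function of its history, so every prefix of a
  history determines the state that training passed through.\<close>

definition latest_state :: "('p, 'x) fats_params \<Rightarrow> ('p, 'x) iteration list \<Rightarrow> ('p, 'x) fats_state" where
  "latest_state p h = (if h = [] then init_model p else global_model (last h), h)"

text \<open>The invariant kept by training and unlearning. The record \<open>x\<close> belongs to
  iteration \<open>length h + 1\<close>. Since clients change only where a round starts, inspecting
  the round starts is enough for deleting a client.\<close>

definition consistent :: "('p, 'x) fats_params \<Rightarrow> ('p, 'x) fats_state \<Rightarrow> bool" where
  "consistent p s \<longleftrightarrow> s = latest_state p (snd s) \<and>
     (\<forall>h x r. snd s = h @ x # r \<longrightarrow> length h + 1 \<notin> round_starts p \<longrightarrow> clients x = clients (last h))"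

lemma snd_latest_state [simp]: "snd (latest_state p h) = h"
  by (simp add: latest_state_def)

lemma consistent_latest_state: "consistent p s \<Longrightarrow> s = latest_state p (snd s)"
  by (simp add: consistent_def)

lemma consistent_clients:
  "consistent p s \<Longrightarrow> snd s = h @ x # r \<Longrightarrow> length h + 1 \<notin> round_starts p \<Longrightarrow>
    clients x = clients (last h)"
  by (simp add: consistent_def)

lemma consistent_prefix:
  "consistent p s \<Longrightarrow> snd s = h @ r \<Longrightarrow> consistent p (latest_state p h)"
  by (auto simp: consistent_def)

lemma consistent_init_state [simp]: "consistent p (init_state p)"
  by (simp add: consistent_def init_state_def latest_state_def)

lemma one_in_round_starts: "1 \<in> round_starts p"
  by (auto simp: round_starts_def)

lemma rewind_latest_state:
  "snd s = h @ r \<Longrightarrow> rewind p (length h + 1) s = latest_state p h"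
  by (auto simp: rewind_def latest_state_def nth_append last_conv_nth)

text \<open>Abstracts from the gradient step: what later proofs use is that one record is appended,
  that it carries the clients and batches drawn, and that it repeats the current global
  model.\<close>

lemma update_append:
  obtains x where "update p P B s = (global_model x, snd s @ [x])" "clients x = P" "batch x = B"
proof (rule that[of "last (snd (update p P B s))"])
qed (cases s; simp add: update_def Let_def)+

lemma last_update [simp]:
  "clients (last (snd (update p P B s))) = P" "batch (last (snd (update p P B s))) = B"
  using update_append[of p P B s] by (metis last_snoc snd_conv)+

lemma snd_update: "snd (update p P B s) = snd s @ [last (snd (update p P B s))]"
  using update_append[of p P B s] by (metis last_snoc snd_conv)

lemma consistent_update:
  assumes "consistent p s" "length (snd s) + 1 \<notin> round_starts p \<Longrightarrow> P = clients (last (snd s))"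
  shows "consistent p (update p P B s)"
proof -
  obtain x where x: "update p P B s = (global_model x, snd s @ [x])" "clients x = P"
    by (rule update_append)
  show ?thesis
    unfolding consistent_def
  proof (intro conjI allI impI)
    show "update p P B s = latest_state p (snd (update p P B s))"
      by (simp add: x latest_state_def)
    fix h y r
    assume eq: "snd (update p P B s) = h @ y # r" and start: "length h + 1 \<notin> round_starts p"
    show "clients y = clients (last h)"
    \<comment> \<open>With \<open>r\<close> empty, \<open>y\<close> is the new record and the
      condition on \<open>P\<close> applies; otherwise \<open>y\<close> was already in the history
      of \<open>s\<close>.\<close>
    proof (cases r rule: rev_cases)
      case Nil
      then show ?thesis using eq x start assms(2) by simp
    next
      case (snoc r' z)
      then have "snd s = h @ y # r'" using eq x by simp
      then show ?thesis using consistent_clients[OF assms(1)] start by blast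
    qed
  qed
qed

lemma iterate_with_update:
  assumes "s' \<in> set_pmf (iterate_with p D P s)"
  obtains B where "s' = update p P B s"
  using assms by (auto simp: iterate_with_def)

lemma iterate_update:
  assumes "s' \<in> set_pmf (iterate p D s)"
  obtains P B where "s' = update p P B s" "length (snd s) + 1 \<notin> round_starts p \<Longrightarrow> P = clients (last (snd s))"
  using assms by (auto simp: iterate_def split: if_splits elim!: iterate_with_update)

lemma iterate_append:
  assumes "s' \<in> set_pmf (iterate p D s)"
  shows "snd s' = snd s @ [last (snd s')]"
  using iterate_update[OF assms] snd_update by metis

lemma length_iterate: "s' \<in> set_pmf (iterate p D s) \<Longrightarrow> length (snd s') = Suc (length (snd s))"
  by (drule iterate_append) (metis length_append_singleton)

lemma consistent_iterate:
  "s' \<in> set_pmf (iterate p D s) \<Longrightarrow> consistent p s \<Longrightarrow> consistent p s'"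
  by (metis iterate_update consistent_update)

section \<open>Composition of training runs\<close>

lemma funpow_bind_pmf:
  fixes f :: "'a \<Rightarrow> 'a pmf"
  shows "((\<lambda>\<mu>. bind_pmf \<mu> f) ^^ n) \<mu> = bind_pmf \<mu> (\<lambda>x. ((\<lambda>\<mu>. bind_pmf \<mu> f) ^^ n) (return_pmf x))"
proof (induction n)
  case (Suc n)
  have "((\<lambda>\<mu>. bind_pmf \<mu> f) ^^ Suc n) \<mu> = bind_pmf (((\<lambda>\<mu>. bind_pmf \<mu> f) ^^ n) \<mu>) f" by simp
  also have "\<dots> = bind_pmf (bind_pmf \<mu> (\<lambda>x. ((\<lambda>\<mu>. bind_pmf \<mu> f) ^^ n) (return_pmf x))) f"
    by (subst Suc) simp
  finally show ?case by (simp add: bind_assoc_pmf)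
qed (simp add: bind_return_pmf')

lemma fats_train_done: "t \<le> length (snd s) \<Longrightarrow> fats_train p D t s = return_pmf s"
  by (simp add: fats_train_def)

text \<open>\<open>fats_train\<close> adds iterations at the end; inductions on the remaining steps
  need the first one split off instead.\<close>

lemma fats_train_step:
  assumes "length (snd s) < t"
  shows "fats_train p D t s = bind_pmf (iterate p D s) (fats_train p D t)"
proof -
  from assms have n: "t - length (snd s) = Suc (t - Suc (length (snd s)))" by simp
  have "fats_train p D t s =
      ((\<lambda>\<mu>. bind_pmf \<mu> (iterate p D)) ^^ (t - Suc (length (snd s)))) (iterate p D s)"
    unfolding fats_train_def n by (simp only: funpow_Suc_right o_apply bind_return_pmf)
  also have "\<dots> = bind_pmf (iterate p D s) (fats_train p D t)"
    by (subst funpow_bind_pmf, rule bind_pmf_cong) (simp_all add: fats_train_def length_iterate)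
  finally show ?thesis .
qed

lemma fats_train_Suc:
  "length (snd s) \<le> t \<Longrightarrow> fats_train p D (Suc t) s = bind_pmf (fats_train p D t s) (iterate p D)"
  by (simp add: fats_train_def Suc_diff_le)

text \<open>The Chapman-Kolmogorov property of the chain of iterations. It also covers a state
  already past \<open>t\<close>, for which the first run does nothing.\<close>

lemma fats_train_fats_train:
  assumes "t \<le> T"
  shows "bind_pmf (fats_train p D t s) (fats_train p D T) = fats_train p D T s"
proof (induction "t - length (snd s)" arbitrary: s)
  case 0
  then show ?case by (simp add: fats_train_done bind_return_pmf)
next
  case (Suc n)
  then have "length (snd s) < t" by simp
  with assms Suc show ?case
    unfolding fats_train_step[OF \<open>length (snd s) < t\<close>] fats_train_step[OF less_le_trans[OF \<open>length (snd s) < t\<close> assms]]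
      bind_assoc_pmf
    by (intro bind_pmf_cong refl Suc.hyps(1)) (simp add: length_iterate)
qed

lemma fats_train_extends:
  assumes "s' \<in> set_pmf (fats_train p D t s)"
  shows length_fats_train: "length (snd s') = max t (length (snd s))"
    and fats_train_append: "\<exists>r. snd s' = snd s @ r"
    and consistent_fats_train: "consistent p s \<Longrightarrow> consistent p s'"
proof -
  have "(\<exists>r. snd s' = snd s @ r) \<and> length (snd s') = max t (length (snd s)) \<and>
      (consistent p s \<longrightarrow> consistent p s')"
    using assms
  proof (induction "t - length (snd s)" arbitrary: s)
    case 0
    then show ?case by (simp add: fats_train_done)
  next
    case (Suc n)
    then have len: "length (snd s) < t" by simp
    with Suc obtain s1 where s1: "s1 \<in> set_pmf (iterate p D s)" "s' \<in> set_pmf (fats_train p D t s1)"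
      by (auto simp: fats_train_step[of s])
    from Suc length_iterate[OF s1(1)] have "n = t - length (snd s1)" by simp
    from Suc(1)[OF this s1(2)] len length_iterate[OF s1(1)] consistent_iterate[OF s1(1)]
    have IH: "\<exists>r. snd s' = snd s1 @ r" "length (snd s') = max t (length (snd s))"
      "consistent p s \<longrightarrow> consistent p s'" by auto
    then obtain r where "snd s' = snd s1 @ r" by blast
    then have "snd s' = snd s @ last (snd s1) # r"
      using iterate_append[OF s1(1)] by (metis append.assoc append_Cons append_Nil)
    with IH show ?case by blast
  qed
  then show "length (snd s') = max t (length (snd s))" "\<exists>r. snd s' = snd s @ r"
    "consistent p s \<Longrightarrow> consistent p s'" by blast+
qed

section \<open>Unlearning by resampling the first affected iteration\<close>

definition untouched :: "(('p, 'x) iteration \<Rightarrow> bool) \<Rightarrow> ('p, 'x) fats_state \<Rightarrow> bool" where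
  "untouched bad s \<longleftrightarrow> (\<forall>x\<in>set (snd s). \<not> bad x)"

lemma untouched_iterate:
  "s' \<in> set_pmf (iterate p D s) \<Longrightarrow> untouched bad s' \<longleftrightarrow> untouched bad s \<and> \<not> bad (last (snd s'))"
  unfolding untouched_def by (drule iterate_append) (metis UnE UnI1 UnI2 empty_iff insert_iff list.set(1) list.simps(15) set_append)

lemma fats_train_touched:
  "s' \<in> set_pmf (fats_train p D t s) \<Longrightarrow> \<not> untouched bad s \<Longrightarrow> \<not> untouched bad s'"
  by (drule fats_train_append) (auto simp: untouched_def)

text \<open>The common pattern of both deletions. \<open>bad\<close> marks the iterations that
  involve the deleted item, and \<open>redo h x\<close> replaces the first bad record
  \<open>x\<close> after the history \<open>h\<close>; it receives \<open>x\<close> so that the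
  clients of \<open>x\<close> can be kept when a sample is deleted. \<open>resample\<close> is
  exactness for a single iteration.\<close>

locale resampling_unlearning =
  fixes p :: "('p::euclidean_space, 'x) fats_params"
    and D D' :: "'x fdata"
    and bad :: "('p, 'x) iteration \<Rightarrow> bool"
    and redo :: "('p, 'x) iteration list \<Rightarrow> ('p, 'x) iteration \<Rightarrow> ('p, 'x) fats_state pmf"
    and unlearn :: "('p, 'x) fats_state \<Rightarrow> (bool \<times> ('p, 'x) fats_state) pmf"
  assumes horizon_pos: "0 < horizon p"
    and resample: "consistent p s \<Longrightarrow> untouched bad s \<Longrightarrow>
      bind_pmf (iterate p D s) (\<lambda>s'. if bad (last (snd s')) then redo (snd s) (last (snd s')) else return_pmf s') =
      iterate p D' s"
    and redo_consistent: "consistent p s \<Longrightarrow> snd s = h @ x # r \<Longrightarrow> s' \<in> set_pmf (redo h x) \<Longrightarrow>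
      consistent p s'"
    and unlearn_untouched: "untouched bad s \<Longrightarrow> snd s \<noteq> [] \<Longrightarrow> unlearn s = return_pmf (False, s)"
    and unlearn_touched: "consistent p s \<Longrightarrow> snd s = h @ x # r \<Longrightarrow> \<forall>y\<in>set h. \<not> bad y \<Longrightarrow> bad x \<Longrightarrow>
      unlearn s = map_pmf (Pair True) (bind_pmf (redo h x) (fats_train p D' (horizon p)))"
begin

definition unlearned where "unlearned s = map_pmf snd (unlearn s)"

lemma unlearned_untouched: "untouched bad s \<Longrightarrow> snd s \<noteq> [] \<Longrightarrow> unlearned s = return_pmf s"
  by (simp add: unlearned_def unlearn_untouched)

lemma unlearned_touched:
  "consistent p s \<Longrightarrow> snd s = h @ x # r \<Longrightarrow> \<forall>y\<in>set h. \<not> bad y \<Longrightarrow> bad x \<Longrightarrow>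
    unlearned s = bind_pmf (redo h x) (fats_train p D' (horizon p))"
  by (simp add: unlearned_def unlearn_touched pmf.map_comp o_def)

lemma touched_split:
  assumes "\<not> untouched bad s"
  obtains h x r where "snd s = h @ x # r" "\<forall>y\<in>set h. \<not> bad y" "bad x"
proof -
  from assms have "\<exists>x\<in>set (snd s). bad x" by (simp add: untouched_def)
  then show thesis by (rule split_list_first_propE) (rule that)
qed

text \<open>Induction on the number of iterations left. After a good iteration the old run goes on;
  after a bad one unlearning throws away all that follows, so that only \<open>redo\<close> remains.
  \<open>resample\<close> merges the two cases into one iteration on \<open>D'\<close>.\<close>

lemma train_unlearned:
  assumes "consistent p s" "untouched bad s"
  shows "bind_pmf (fats_train p D (horizon p) s) unlearned = fats_train p D' (horizon p) s"
  using assms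
proof (induction "horizon p - length (snd s)" arbitrary: s)
  case 0
  then have "snd s \<noteq> []" using horizon_pos by auto
  with 0 show ?case by (simp add: fats_train_done bind_return_pmf unlearned_untouched)
next
  case (Suc n)
  then have len: "length (snd s) < horizon p" by simp
  have "bind_pmf (fats_train p D (horizon p) s) unlearned =
      bind_pmf (iterate p D s) (\<lambda>s'. bind_pmf (fats_train p D (horizon p) s') unlearned)"
    by (simp add: fats_train_step[OF len] bind_assoc_pmf)
  also have "\<dots> = bind_pmf (iterate p D s) (\<lambda>s'.
      bind_pmf (if bad (last (snd s')) then redo (snd s) (last (snd s')) else return_pmf s')
        (fats_train p D' (horizon p)))"
  proof (rule bind_pmf_cong[OF refl])
    fix s' assume s': "s' \<in> set_pmf (iterate p D s)"
    let ?x = "last (snd s')"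
    show "bind_pmf (fats_train p D (horizon p) s') unlearned =
      bind_pmf (if bad ?x then redo (snd s) ?x else return_pmf s') (fats_train p D' (horizon p))"
    proof (cases "bad ?x")
      case False
      with Suc s' have "untouched bad s'" by (simp add: untouched_iterate)
      with Suc False s' show ?thesis
        by (simp add: length_iterate consistent_iterate bind_return_pmf)
    next
      case True
      \<comment> \<open>Training only appends, so \<open>?x\<close> stays the first bad record and
        the law of the unlearned state does not depend on \<open>s''\<close>.\<close>
      have "unlearned s'' = bind_pmf (redo (snd s) ?x) (fats_train p D' (horizon p))"
        if s'': "s'' \<in> set_pmf (fats_train p D (horizon p) s')" for s''
      proof -
        obtain r where r: "snd s'' = snd s' @ r" "consistent p s''"
          using fats_train_extends[OF s''] consistent_iterate[OF s'] Suc.prems by blast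
        then have "snd s'' = snd s @ ?x # r" using iterate_append[OF s'] by (metis append.assoc append_Cons append_Nil)
        with True r Suc.prems show ?thesis
          by (intro unlearned_touched) (auto simp: untouched_def)
      qed
      then show ?thesis using True by (simp cong: bind_pmf_cong)
    qed
  qed
  also have "\<dots> = bind_pmf (iterate p D' s) (fats_train p D' (horizon p))"
    by (simp add: bind_assoc_pmf[symmetric] resample Suc.prems)
  finally show ?case by (simp add: fats_train_step[OF len])
qed

text \<open>This moves training in front of a request. From an untouched state both sides are runs
  on \<open>D'\<close>. From a touched one the continuation leaves the first bad record in place and
  is discarded, while a re-computed state is already complete.\<close>

lemma unlearned_train:
  assumes "consistent p s" "snd s \<noteq> []"
  shows "bind_pmf (unlearned s) (fats_train p D' (horizon p)) =
    bind_pmf (fats_train p D (horizon p) s) unlearned"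
proof (cases "untouched bad s")
  case True
  with assms show ?thesis by (simp add: unlearned_untouched bind_return_pmf train_unlearned)
next
  case False
  then obtain h x r where s: "snd s = h @ x # r" "\<forall>y\<in>set h. \<not> bad y" "bad x" by (rule touched_split)
  have "unlearned s' = bind_pmf (redo h x) (fats_train p D' (horizon p))"
    if s': "s' \<in> set_pmf (fats_train p D (horizon p) s)" for s'
  proof -
    obtain r' where "snd s' = snd s @ r'" "consistent p s'"
      using fats_train_append[OF s'] consistent_fats_train[OF s'] assms by blast
    with s show ?thesis by (intro unlearned_touched[of _ _ _ "r @ r'"]) auto
  qed
  then have "bind_pmf (fats_train p D (horizon p) s) unlearned = bind_pmf (redo h x) (fats_train p D' (horizon p))"
    by (simp cong: bind_pmf_cong)
  then show ?thesis
    using unlearned_touched[OF assms(1) s] by (simp add: bind_assoc_pmf fats_train_fats_train)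
qed

lemma consistent_unlearned:
  assumes "consistent p s" "snd s \<noteq> []" "s' \<in> set_pmf (unlearned s)"
  shows "consistent p s'"
proof (cases "untouched bad s")
  case True
  with assms show ?thesis by (simp add: unlearned_untouched)
next
  case False
  then obtain h x r where s: "snd s = h @ x # r" "\<forall>y\<in>set h. \<not> bad y" "bad x" by (rule touched_split)
  then obtain s1 where "s1 \<in> set_pmf (redo h x)" "s' \<in> set_pmf (fats_train p D' (horizon p) s1)"
    using assms unlearned_touched[OF assms(1) s] by auto
  then show ?thesis using redo_consistent[OF assms(1) s(1)] consistent_fats_train by blast
qed

text \<open>A coupling: by \<open>train_unlearned\<close> a run on \<open>D'\<close> arises by
  unlearning from a run on \<open>D\<close>, and the two agree unless the latter is touched.\<close>

lemma prob_fats_train_le: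
  assumes "consistent p s" "untouched bad s"
  shows "measure_pmf.prob (fats_train p D' (horizon p) s) A \<le>
    measure_pmf.prob (fats_train p D (horizon p) s) (A \<union> {s'. \<not> untouched bad s'})"
proof -
  have "measure_pmf.prob (unlearned s') A \<le> measure_pmf.prob (return_pmf s') (A \<union> {s'. \<not> untouched bad s'})"
    if "s' \<in> set_pmf (fats_train p D (horizon p) s)" for s'
  proof (cases "untouched bad s'")
    case True
    have "length (snd s') = max (horizon p) (length (snd s))"
      using that by (rule length_fats_train)
    with horizon_pos have "snd s' \<noteq> []" by auto
    with True show ?thesis by (simp add: unlearned_untouched indicator_def)
  qed (simp add: measure_pmf.prob_le_1)
  then show ?thesis
    using prob_bind_pmf_le[of "fats_train p D (horizon p) s" unlearned A 1 return_pmf "A \<union> {s'. \<not> untouched bad s'}" 0]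
    by (simp add: train_unlearned[OF assms] bind_return_pmf')
qed

end

section \<open>Sequences of requests\<close>

lemma request_sequence_Cons:
  "request_sequence deletion \<A> T D ((t, D') # rs) \<Longrightarrow>
    deletion D D' \<and> D' \<in> \<A> \<and> 1 \<le> t \<and> t \<le> T \<and> request_sequence deletion \<A> T D' rs"
  by (auto simp: request_sequence_def)

text \<open>Idealised service, in which all requests come after the training is complete.\<close>

fun unlearn_all ::
  "('x fdata \<Rightarrow> 'x fdata \<Rightarrow> 's \<Rightarrow> (bool \<times> 's) pmf) \<Rightarrow> 'x fdata \<Rightarrow> (nat \<times> 'x fdata) list \<Rightarrow> 's \<Rightarrow> 's pmf"
where
  "unlearn_all unlearn D [] s = return_pmf s"
| "unlearn_all unlearn D ((t, D') # rs) s =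
     bind_pmf (map_pmf snd (unlearn D' (sym_diff D D') s)) (unlearn_all unlearn D' rs)"

text \<open>All requests are tested against the same state, so that the event can be measured under
  a single run on the original data.\<close>

fun touched ::
  "('x fdata \<Rightarrow> 'x fdata \<Rightarrow> ('p, 'x) iteration \<Rightarrow> bool) \<Rightarrow> 'x fdata \<Rightarrow> (nat \<times> 'x fdata) list \<Rightarrow>
    ('p, 'x) fats_state \<Rightarrow> bool"
where
  "touched bad D [] s \<longleftrightarrow> False"
| "touched bad D ((t, D') # rs) s \<longleftrightarrow> \<not> untouched (bad D D') s \<or> touched bad D' rs s"

context
  fixes p :: "('p::euclidean_space, 'x) fats_params"
    and deletion :: "'x fdata \<Rightarrow> 'x fdata \<Rightarrow> bool"
    and \<A> :: "'x fdata set"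
    and bad :: "'x fdata \<Rightarrow> 'x fdata \<Rightarrow> ('p, 'x) iteration \<Rightarrow> bool"
    and redo :: "'x fdata \<Rightarrow> 'x fdata \<Rightarrow> ('p, 'x) iteration list \<Rightarrow> ('p, 'x) iteration \<Rightarrow> ('p, 'x) fats_state pmf"
    and unlearn :: "'x fdata \<Rightarrow> 'x fdata \<Rightarrow> ('p, 'x) fats_state \<Rightarrow> (bool \<times> ('p, 'x) fats_state) pmf"
  assumes unlearning: "\<And>D D'. D \<in> \<A> \<Longrightarrow> D' \<in> \<A> \<Longrightarrow> deletion D D' \<Longrightarrow>
    resampling_unlearning p D D' (bad D D') (redo D D') (unlearn D' (sym_diff D D'))"
begin

text \<open>
  Completing the training commutes with unlearning, so that all training can be moved in front of
  the requests. This is stated for whole distributions: a state that has been re-computed is already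
  complete when the next request arrives, whereas other states are not.
\<close>

lemma serve_eq_unlearn_all:
  assumes "request_sequence deletion \<A> (horizon p) D rs" "D \<in> \<A>" "consistent p s"
  shows "map_pmf snd (serve (fats_train p) unlearn (horizon p) D rs s) =
    bind_pmf (fats_train p D (horizon p) s) (unlearn_all unlearn D rs)"
  using assms
proof (induction rs arbitrary: D s)
  case Nil
  have "unlearn_all unlearn D [] = return_pmf" by (rule ext) simp
  then show ?case by (simp add: pmf.map_comp o_def bind_return_pmf')
next
  case (Cons request rs)
  obtain t D' where request: "request = (t, D')" by (cases request)
  from Cons.prems(1) have del: "deletion D D'" "D' \<in> \<A>" and t: "1 \<le> t" "t \<le> horizon p"
    and rs: "request_sequence deletion \<A> (horizon p) D' rs"
    unfolding request by (blast dest: request_sequence_Cons)+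
  interpret resampling_unlearning p D D' "bad D D'" "redo D D'" "unlearn D' (sym_diff D D')"
    using unlearning del Cons.prems by blast
  have "map_pmf snd (serve (fats_train p) unlearn (horizon p) D (request # rs) s) =
      bind_pmf (fats_train p D t s) (\<lambda>s1. bind_pmf (unlearned s1)
        (\<lambda>s2. map_pmf snd (serve (fats_train p) unlearn (horizon p) D' rs s2)))"
    by (simp add: request unlearned_def map_bind_pmf bind_map_pmf map_pmf_def[of snd] bind_assoc_pmf
        bind_return_pmf case_prod_beta)
  also have "\<dots> = bind_pmf (fats_train p D t s) (\<lambda>s1. bind_pmf (unlearned s1)
        (\<lambda>s2. bind_pmf (fats_train p D' (horizon p) s2) (unlearn_all unlearn D' rs)))"
  proof (intro bind_pmf_cong refl)
    fix s1 s2 assume s1: "s1 \<in> set_pmf (fats_train p D t s)" and s2: "s2 \<in> set_pmf (unlearned s1)"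
    have "consistent p s1" using consistent_fats_train[OF s1] Cons.prems(3) by blast
    moreover have "length (snd s1) \<ge> t" using length_fats_train[OF s1] by simp
    \<comment> \<open>Arrival steps are at least 1, so a request never meets an empty history, as
      \<open>consistent_unlearned\<close> requires.\<close>
    then have "snd s1 \<noteq> []" using t by auto
    ultimately have "consistent p s2" using s2 by (rule consistent_unlearned)
    then show "map_pmf snd (serve (fats_train p) unlearn (horizon p) D' rs s2) =
        bind_pmf (fats_train p D' (horizon p) s2) (unlearn_all unlearn D' rs)"
      using Cons.IH rs del by blast
  qed
  \<comment> \<open>Here \<open>unlearned_train\<close> exchanges completion on \<open>D'\<close>
    after the request for completion on \<open>D\<close> before it.\<close>
  also have "\<dots> = bind_pmf (fats_train p D t s) (\<lambda>s1.
      bind_pmf (bind_pmf (fats_train p D (horizon p) s1) unlearned) (unlearn_all unlearn D' rs))"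
  proof (rule bind_pmf_cong[OF refl])
    fix s1 assume s1: "s1 \<in> set_pmf (fats_train p D t s)"
    have "consistent p s1" using consistent_fats_train[OF s1] Cons.prems(3) by blast
    moreover have "length (snd s1) \<ge> t" using length_fats_train[OF s1] by simp
    then have "snd s1 \<noteq> []" using t by auto
    ultimately show "bind_pmf (unlearned s1)
        (\<lambda>s2. bind_pmf (fats_train p D' (horizon p) s2) (unlearn_all unlearn D' rs)) =
      bind_pmf (bind_pmf (fats_train p D (horizon p) s1) unlearned) (unlearn_all unlearn D' rs)"
      by (simp add: unlearned_train[symmetric] bind_assoc_pmf)
  qed
  also have "\<dots> = bind_pmf (bind_pmf (fats_train p D (horizon p) s) unlearned) (unlearn_all unlearn D' rs)"
    unfolding fats_train_fats_train[OF t(2), of p D s, symmetric] by (simp add: bind_assoc_pmf)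
  finally show ?case
    by (simp add: request unlearned_def bind_assoc_pmf cong: bind_pmf_cong)
qed

text \<open>The initial history has no bad record, so at every request
  \<open>train_unlearned\<close> turns a complete run on the current data into one on the next
  data.\<close>

lemma train_unlearn_all:
  assumes "request_sequence deletion \<A> (horizon p) D rs" "D \<in> \<A>"
  shows "bind_pmf (fats_train p D (horizon p) (init_state p)) (unlearn_all unlearn D rs) =
    fats_train p (remaining_data D rs) (horizon p) (init_state p)"
  using assms
proof (induction rs arbitrary: D)
  case Nil
  have "unlearn_all unlearn D [] = return_pmf" by (rule ext) simp
  then show ?case by (simp add: remaining_data_def bind_return_pmf')
next
  case (Cons request rs)
  obtain t D' where request: "request = (t, D')" by (cases request)
  from Cons.prems(1) have del: "deletion D D'" "D' \<in> \<A>"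
    and rs: "request_sequence deletion \<A> (horizon p) D' rs"
    unfolding request by (blast dest: request_sequence_Cons)+
  interpret resampling_unlearning p D D' "bad D D'" "redo D D'" "unlearn D' (sym_diff D D')"
    using unlearning del Cons.prems by blast
  have "bind_pmf (fats_train p D (horizon p) (init_state p)) (unlearn_all unlearn D (request # rs)) =
      bind_pmf (bind_pmf (fats_train p D (horizon p) (init_state p)) unlearned) (unlearn_all unlearn D' rs)"
    by (simp add: request unlearned_def bind_assoc_pmf cong: bind_pmf_cong)
  also have "bind_pmf (fats_train p D (horizon p) (init_state p)) unlearned =
      fats_train p D' (horizon p) (init_state p)"
    by (rule train_unlearned) (simp_all add: untouched_def, simp add: init_state_def)
  finally show ?case
    using Cons.IH[OF rs del(2)] by (simp add: remaining_data_def request)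
qed

lemma exact_unlearning_fats:
  "exact_unlearning deletion \<A> (horizon p) (init_state p) (fats_train p) unlearn"
  unfolding exact_unlearning_def by (simp add: serve_eq_unlearn_all train_unlearn_all)

text \<open>\<open>unlearn'\<close> may be any procedure that leaves untouched states alone: once it
  re-computes, the event has happened, whatever follows. This covers the exact and the redrawing
  variant at once; the exact \<open>unlearn\<close> serves to compare runs on \<open>D'\<close> with
  runs on \<open>D\<close>.\<close>

lemma prob_recompute_le_prob_touched:
  assumes "request_sequence deletion \<A> (horizon p) D rs" "D \<in> \<A>" "consistent p s"
    and unchanged: "\<And>D D' s. D \<in> \<A> \<Longrightarrow> D' \<in> \<A> \<Longrightarrow> deletion D D' \<Longrightarrow> untouched (bad D D') s \<Longrightarrow>
      snd s \<noteq> [] \<Longrightarrow> unlearn' D' (sym_diff D D') s = return_pmf (False, s)"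
  shows "measure_pmf.prob (serve (fats_train p) unlearn' (horizon p) D rs s) {(c, s). c} \<le>
    measure_pmf.prob (fats_train p D (horizon p) s) {s'. touched bad D rs s'}"
  using assms(1-3)
proof (induction rs arbitrary: D s)
  case Nil
  have "Pair False -` {(c, s). c} = {}" by auto
  then show ?case by simp
next
  case (Cons request rs)
  obtain t D' where request: "request = (t, D')" by (cases request)
  from Cons.prems(1) have del: "deletion D D'" "D' \<in> \<A>" and t: "1 \<le> t" "t \<le> horizon p"
    and rs: "request_sequence deletion \<A> (horizon p) D' rs"
    unfolding request by (blast dest: request_sequence_Cons)+
  interpret resampling_unlearning p D D' "bad D D'" "redo D D'" "unlearn D' (sym_diff D D')"
    using unlearning del Cons.prems by blast
  define rest where "rest s1 = do {
     (c, s2) \<leftarrow> unlearn' D' (sym_diff D D') s1;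
     (c', s3) \<leftarrow> serve (fats_train p) unlearn' (horizon p) D' rs s2;
     return_pmf (c \<or> c', s3)}" for s1
  have "measure_pmf.prob (rest s1) {(c, s). c} \<le>
      measure_pmf.prob (fats_train p D (horizon p) s1) {s'. touched bad D (request # rs) s'}"
    if s1: "s1 \<in> set_pmf (fats_train p D t s)" for s1
  proof (cases "untouched (bad D D') s1")
    case True
    have cons: "consistent p s1" using consistent_fats_train[OF s1] Cons.prems(3) by blast
    have "length (snd s1) \<ge> t" using length_fats_train[OF s1] by simp
    then have "snd s1 \<noteq> []" using t by auto
    then have "rest s1 = serve (fats_train p) unlearn' (horizon p) D' rs s1"
      using True unchanged del Cons.prems
      by (simp add: rest_def bind_return_pmf bind_return_pmf')
    then have "measure_pmf.prob (rest s1) {(c, s). c} \<le>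
        measure_pmf.prob (fats_train p D' (horizon p) s1) {s'. touched bad D' rs s'}"
      using Cons.IH[OF rs del(2) cons] by simp
    \<comment> \<open>Passing from a run on \<open>D'\<close> to one on \<open>D\<close> costs the
      event that the present request touches the run, which \<open>touched\<close> includes
      anyway.\<close>
    also have "\<dots> \<le> measure_pmf.prob (fats_train p D (horizon p) s1)
        ({s'. touched bad D' rs s'} \<union> {s'. \<not> untouched (bad D D') s'})"
      using cons True by (rule prob_fats_train_le)
    also have "{s'. touched bad D' rs s'} \<union> {s'. \<not> untouched (bad D D') s'} =
        {s'. touched bad D (request # rs) s'}"
      by (auto simp: request)
    finally show ?thesis .
  next
    case False
    \<comment> \<open>Touched states stay touched, so the bound is 1 here.\<close>
    then have "measure_pmf.prob (fats_train p D (horizon p) s1) {s'. touched bad D (request # rs) s'} = 1"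
      by (subst measure_pmf.prob_eq_1) (auto simp: AE_measure_pmf_iff request dest: fats_train_touched)
    then show ?thesis by (simp add: measure_pmf.prob_le_1)
  qed
  then have "measure_pmf.prob (bind_pmf (fats_train p D t s) rest) {(c, s). c} \<le>
      1 * measure_pmf.prob (bind_pmf (fats_train p D t s) (fats_train p D (horizon p)))
        {s'. touched bad D (request # rs) s'} + 0"
    by (intro prob_bind_pmf_le) simp
  moreover have "serve (fats_train p) unlearn' (horizon p) D (request # rs) s =
      bind_pmf (fats_train p D t s) rest"
    by (simp add: request rest_def[abs_def])
  ultimately show ?case by (simp add: fats_train_fats_train[OF t(2)] del: serve.simps)
qed

text \<open>A union bound under the fixed law \<open>q\<close>. The data \<open>D\<close> shrink
  along the requests while \<open>D0\<close> stays, so one constant \<open>c\<close> serves all of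
  them.\<close>

lemma prob_touched_le:
  assumes "request_sequence deletion \<A> T D rs" "D \<in> \<A>" "D \<subseteq> D0"
    and bound: "\<And>D D'. D \<in> \<A> \<Longrightarrow> D \<subseteq> D0 \<Longrightarrow> deletion D D' \<Longrightarrow>
      D' \<subseteq> D \<and> measure_pmf.prob q {s. \<not> untouched (bad D D') s} \<le> c"
  shows "measure_pmf.prob q {s. touched bad D rs s} \<le> c * real (length rs)"
  using assms(1-3)
proof (induction rs arbitrary: D)
  case Nil
  have "{s. touched bad D [] s} = {}" by simp
  then show ?case by (simp only: measure_empty list.size of_nat_0 mult_zero_right order_refl)
next
  case (Cons request rs)
  obtain t D' where request: "request = (t, D')" by (cases request)
  from Cons.prems(1) have del: "deletion D D'" "D' \<in> \<A>"
    and rs: "request_sequence deletion \<A> T D' rs"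
    unfolding request by (blast dest: request_sequence_Cons)+
  have D': "D' \<subseteq> D" and le: "measure_pmf.prob q {s. \<not> untouched (bad D D') s} \<le> c"
    using bound del Cons.prems by blast+
  have "measure_pmf.prob q {s. touched bad D (request # rs) s} =
      measure_pmf.prob q ({s. \<not> untouched (bad D D') s} \<union> {s. touched bad D' rs s})"
    by (rule arg_cong[where f = "measure_pmf.prob q"]) (auto simp: request)
  also have "\<dots> \<le> measure_pmf.prob q {s. \<not> untouched (bad D D') s} +
      measure_pmf.prob q {s. touched bad D' rs s}"
    by (rule measure_Un_le) simp_all
  also have "measure_pmf.prob q {s. touched bad D' rs s} \<le> c * real (length rs)"
    using Cons.IH[OF rs del(2)] D' Cons.prems by auto
  finally show ?case using le by (simp add: algebra_simps)
qed

lemma recomputation_prob_le: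
  assumes "request_sequence deletion \<A> (horizon p) D rs" "D \<in> \<A>"
    and "\<And>D D' s. D \<in> \<A> \<Longrightarrow> D' \<in> \<A> \<Longrightarrow> deletion D D' \<Longrightarrow> untouched (bad D D') s \<Longrightarrow>
      snd s \<noteq> [] \<Longrightarrow> unlearn' D' (sym_diff D D') s = return_pmf (False, s)"
    and "\<And>D1 D'. D1 \<in> \<A> \<Longrightarrow> D1 \<subseteq> D \<Longrightarrow> deletion D1 D' \<Longrightarrow> D' \<subseteq> D1 \<and>
      measure_pmf.prob (fats_train p D (horizon p) (init_state p)) {s. \<not> untouched (bad D1 D') s} \<le> c"
  shows "recomputation_prob (horizon p) (init_state p) (fats_train p) unlearn' D rs \<le> c * real (length rs)"
  unfolding recomputation_prob_def
proof (rule order_trans)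
  show "measure_pmf.prob (serve (fats_train p) unlearn' (horizon p) D rs (init_state p)) {(c, s). c} \<le>
      measure_pmf.prob (fats_train p D (horizon p) (init_state p)) {s. touched bad D rs s}"
    by (rule prob_recompute_le_prob_touched[OF assms(1,2) consistent_init_state]) (simp add: assms(3))
  show "measure_pmf.prob (fats_train p D (horizon p) (init_state p)) {s. touched bad D rs s} \<le> c * real (length rs)"
    by (rule prob_touched_le[OF assms(1,2) subset_refl]) (simp_all add: assms(4))
qed

end

section \<open>Deletion of a sample\<close>

lemma sample_deletionE:
  assumes "sample_deletion D D'"
  obtains k X where "sym_diff D D' = {(k, X)}" "(k, X) \<in> D" "D' = D - {(k, X)}" "Domain D' = Domain D"
proof -
  from assms have "D' \<subset> D" "Domain D' = Domain D" "card (sym_diff D D') = 1"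
    by (auto simp: sample_deletion_def)
  then obtain z where "sym_diff D D' = {z}" by (auto simp: card_1_singleton_iff)
  with \<open>D' \<subset> D\<close> have "z \<in> D" "D' = D - {z}" by auto
  with \<open>sym_diff D D' = {z}\<close> \<open>Domain D' = Domain D\<close> show thesis by (cases z) (auto intro: that)
qed

lemma finite_Image_singleton: "finite D \<Longrightarrow> finite (D `` {k})"
  by (rule finite_subset[of _ "snd ` D"]) force+

lemma trainable_batches:
  assumes "D \<in> trainable p" "k \<in> Domain D"
  shows "finite {B. B \<subseteq> D `` {k} \<and> card B = batch_size p}" "{B. B \<subseteq> D `` {k} \<and> card B = batch_size p} \<noteq> {}"
proof -
  from assms have fin: "finite (D `` {k})" and le: "batch_size p \<le> card (D `` {k})"
    by (auto simp: trainable_def finite_Image_singleton)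
  show "finite {B. B \<subseteq> D `` {k} \<and> card B = batch_size p}" using fin by simp
  show "{B. B \<subseteq> D `` {k} \<and> card B = batch_size p} \<noteq> {}"
    by (rule obtain_subset_with_card_n[OF le]) auto
qed

definition uses_sample :: "nat \<Rightarrow> 'x \<Rightarrow> ('p, 'x) iteration \<Rightarrow> bool" where
  "uses_sample k X x \<longleftrightarrow> k \<in># clients x \<and> X \<in> batch x k"

definition uses_deleted_sample :: "'x fdata \<Rightarrow> 'x fdata \<Rightarrow> ('p, 'x) iteration \<Rightarrow> bool" where
  "uses_deleted_sample D D' = (case the_elem (sym_diff D D') of (k, X) \<Rightarrow> uses_sample k X)"

text \<open>Rejection takes place in the batch of \<open>k\<close> alone, since deleting
  \<open>(k, X)\<close> leaves the local data of all other clients as they were.\<close>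

lemma resample_batches:
  assumes "D \<in> trainable p" "D' \<in> trainable p" "k \<in> Domain D'" "D' = D - {(k, X)}" "k \<in># P"
  shows "bind_pmf (sample_batches p D P) (\<lambda>B. if X \<in> B k then sample_batches p D' P else return_pmf B) =
    sample_batches p D' P"
  unfolding sample_batches_def
proof (rule resample_Pi_pmf)
  let ?S = "{B. B \<subseteq> D `` {k} \<and> card B = batch_size p}"
  let ?T = "{B. B \<subseteq> D' `` {k} \<and> card B = batch_size p}"
  have k: "k \<in> Domain D" using assms by auto
  have eq: "X \<notin> B \<longleftrightarrow> B \<in> ?T" if "B \<in> ?S" for B using that assms(4) by auto
  have "bind_pmf (pmf_of_set ?S) (\<lambda>y. if X \<in> y then pmf_of_set ?T else return_pmf y) =
      bind_pmf (pmf_of_set ?S) (\<lambda>y. if y \<in> ?T then return_pmf y else pmf_of_set ?T)"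
    using eq trainable_batches[OF assms(1) k] by (intro bind_pmf_cong refl) (auto simp del: mem_Collect_eq)
  also have "\<dots> = pmf_of_set ?T"
    using trainable_batches[OF assms(1) k] trainable_batches[OF assms(2,3)] assms(4)
    by (intro resample_pmf_of_set) auto
  finally show "bind_pmf (pmf_of_set ?S) (\<lambda>y. if X \<in> y then pmf_of_set ?T else return_pmf y) = pmf_of_set ?T" .
qed (use assms in \<open>auto intro!: arg_cong[where f = pmf_of_set]\<close>)

lemma sample_batches_cong:
  "(\<And>k. k \<in># P \<Longrightarrow> D `` {k} = D' `` {k}) \<Longrightarrow> sample_batches p D P = sample_batches p D' P"
  unfolding sample_batches_def by (intro Pi_pmf_cong) auto

lemma find_upt_eq_Some:
  assumes "P n" "m \<le> n" "n < N" "\<And>i. m \<le> i \<Longrightarrow> i < n \<Longrightarrow> \<not> P i"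
  shows "find P [m..<N] = Some n"
  unfolding find_Some_iff using assms by (intro exI[of _ "n - m"]) auto

lemma fats_su_with_untouched:
  assumes "untouched (uses_sample k X) s"
  shows "fats_su_with restart D' (length (snd s)) X k s = return_pmf (False, s)"
proof -
  have "find (\<lambda>t. k \<in># clients (snd s ! (t - 1)) \<and> X \<in> batch (snd s ! (t - 1)) k)
      [1..<Suc (length (snd s))] = None"
    using assms by (auto simp: find_None_iff untouched_def uses_sample_def all_set_conv_all_nth)
  then show ?thesis by (simp add: fats_su_with_def)
qed

lemma fats_su_with_touched:
  assumes "snd s = h @ x # r" "\<forall>y\<in>set h. \<not> uses_sample k X y" "uses_sample k X x"
  shows "fats_su_with restart D' (length (snd s)) X k s =
    map_pmf (Pair True) (restart D' (length h + 1) s)"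
proof -
  \<comment> \<open>Iterations are numbered from 1 and list positions from 0, hence
    \<open>length h + 1\<close>.\<close>
  have "find (\<lambda>t. k \<in># clients (snd s ! (t - 1)) \<and> X \<in> batch (snd s ! (t - 1)) k)
      [1..<Suc (length (snd s))] = Some (length h + 1)"
  proof (rule find_upt_eq_Some)
    fix i assume "1 \<le> i" "i < length h + 1"
    then have "i - 1 < length h" by simp
    then have "snd s ! (i - 1) \<in> set h" using assms(1) by (simp add: nth_append)
    with assms(2) show "\<not> (k \<in># clients (snd s ! (i - 1)) \<and> X \<in> batch (snd s ! (i - 1)) k)"
      by (auto simp: uses_sample_def)
  qed (use assms in \<open>auto simp: uses_sample_def\<close>)
  then show ?thesis by (simp add: fats_su_with_def)
qed

text \<open>The clients of the affected iteration are kept and only its batches resampled. The law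
  of the clients is the same for \<open>D\<close> and \<open>D'\<close>, because no client loses its
  last sample.\<close>

lemma resampling_unlearning_fats_su:
  fixes p :: "('p::euclidean_space, 'x) fats_params"
  assumes "0 < horizon p" "D \<in> trainable p" "D' \<in> trainable p" "sample_deletion D D'"
  shows "resampling_unlearning p D D' (uses_deleted_sample D D')
    (\<lambda>h x. iterate_with p D' (clients x) (latest_state p h)) (fats_su p D' (sym_diff D D'))"
proof -
  obtain k X where del: "sym_diff D D' = {(k, X)}" "(k, X) \<in> D" "D' = D - {(k, X)}" "Domain D' = Domain D"
    using assms(4) by (rule sample_deletionE)
  have k: "k \<in> Domain D'" using del by auto
  have bad: "uses_deleted_sample D D' = uses_sample k X"
    by (simp add: uses_deleted_sample_def del(1))
  have su: "fats_su p D' (sym_diff D D') s = fats_su_with (fats_reload p) D' (length (snd s)) X k s" for s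
    by (simp add: fats_su_def del(1))
  show ?thesis
    unfolding bad su
  proof
    show "0 < horizon p" by fact
  next
    fix s :: "('p, 'x) fats_state" assume s: "consistent p s"
    have "bind_pmf (iterate_with p D P s) (\<lambda>s'. if uses_sample k X (last (snd s'))
          then iterate_with p D' (clients (last (snd s'))) s else return_pmf s') =
        iterate_with p D' P s" for P
    proof (cases "k \<in># P")
      case True
      have "bind_pmf (iterate_with p D P s) (\<lambda>s'. if uses_sample k X (last (snd s'))
          then iterate_with p D' (clients (last (snd s'))) s else return_pmf s') =
        bind_pmf (sample_batches p D P) (\<lambda>B. bind_pmf (if X \<in> B k then sample_batches p D' P else return_pmf B)
          (\<lambda>B. return_pmf (update p P B s)))"
        using True by (auto simp: iterate_with_def bind_map_pmf uses_sample_def map_pmf_def bind_return_pmf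
            bind_assoc_pmf intro!: bind_pmf_cong)
      also have "\<dots> = iterate_with p D' P s"
        using resample_batches[OF assms(2,3) k del(3) True]
        by (simp add: bind_assoc_pmf[symmetric] iterate_with_def map_pmf_def)
      finally show ?thesis .
    next
      case False
      \<comment> \<open>If the owner of the sample is absent, the batches have the same law and the
        test never fires.\<close>
      then have "sample_batches p D P = sample_batches p D' P"
        by (intro sample_batches_cong) (use del(3) in auto)
      then have "iterate_with p D P s = iterate_with p D' P s" by (simp add: iterate_with_def)
      moreover have "bind_pmf (iterate_with p D P s) (\<lambda>s'. if uses_sample k X (last (snd s'))
          then iterate_with p D' (clients (last (snd s'))) s else return_pmf s') =
        bind_pmf (iterate_with p D P s) return_pmf"
        using False by (intro bind_pmf_cong refl) (auto simp: uses_sample_def elim!: iterate_with_update)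
      ultimately show ?thesis by (simp add: bind_return_pmf')
    qed
    moreover have "sample_clients p D = sample_clients p D'" by (simp add: sample_clients_def del(4))
    ultimately show "bind_pmf (iterate p D s) (\<lambda>s'. if uses_sample k X (last (snd s'))
          then iterate_with p D' (clients (last (snd s'))) (latest_state p (snd s)) else return_pmf s') =
        iterate p D' s"
      unfolding consistent_latest_state[OF s, symmetric] by (simp add: iterate_def bind_assoc_pmf)
  next
    fix s s' :: "('p, 'x) fats_state" and h x r
    assume "consistent p s" "snd s = h @ x # r" "s' \<in> set_pmf (iterate_with p D' (clients x) (latest_state p h))"
    \<comment> \<open>As the clients of \<open>x\<close> are kept, the condition on clients inside a
      round is inherited from \<open>s\<close>.\<close>
    then show "consistent p s'"
      by (auto elim!: iterate_with_update intro!: consistent_update consistent_prefix consistent_clients)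
  next
    fix s :: "('p, 'x) fats_state" assume "untouched (uses_sample k X) s"
    then show "fats_su_with (fats_reload p) D' (length (snd s)) X k s = return_pmf (False, s)"
      by (rule fats_su_with_untouched)
  next
    fix s :: "('p, 'x) fats_state" and h x r
    assume s: "snd s = h @ x # r" "\<forall>y\<in>set h. \<not> uses_sample k X y" "uses_sample k X x"
    show "fats_su_with (fats_reload p) D' (length (snd s)) X k s =
      map_pmf (Pair True) (bind_pmf (iterate_with p D' (clients x) (latest_state p h)) (fats_train p D' (horizon p)))"
      unfolding fats_su_with_touched[OF s] fats_reload_def rewind_latest_state[OF s(1)]
      by (simp add: s(1))
  qed
qed

text \<open>Both variants behave alike until a re-computation, so the probability bound will hold
  for both.\<close>

lemma fats_su_untouched:
  assumes "sample_deletion D D'" "untouched (uses_deleted_sample D D') s"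
  shows "fats_su p D' (sym_diff D D') s = return_pmf (False, s)"
    and "fats_su_redraw p D' (sym_diff D D') s = return_pmf (False, s)"
proof -
  obtain k X where "sym_diff D D' = {(k, X)}"
    using assms(1) by (rule sample_deletionE)
  then show "fats_su p D' (sym_diff D D') s = return_pmf (False, s)"
    "fats_su_redraw p D' (sym_diff D D') s = return_pmf (False, s)"
    using assms(2) by (simp_all add: uses_deleted_sample_def fats_su_def fats_su_redraw_def fats_su_with_untouched)
qed

section \<open>Deletion of a client\<close>

lemma client_deletionE:
  assumes "client_deletion D D'"
  obtains k where "k \<in> Domain D" "Domain D' = Domain D - {k}" "\<forall>j. j \<noteq> k \<longrightarrow> D' `` {j} = D `` {j}"
    "D' \<subseteq> D" "Domain (sym_diff D D') = {k}"
proof -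
  from assms obtain C' where C': "C' \<subset> Domain D" "card (sym_diff (Domain D) C') = 1"
    and D': "D' = {(k, X) \<in> D. k \<in> C'}"
    by (auto simp: client_deletion_def)
  from C'(2) obtain k where "sym_diff (Domain D) C' = {k}" by (auto simp: card_1_singleton_iff)
  with C'(1) have k: "k \<in> Domain D" "C' = Domain D - {k}" by auto
  show thesis
    by (rule that[of k]) (use k D' in auto)
qed

definition uses_client :: "nat \<Rightarrow> ('p, 'x) iteration \<Rightarrow> bool" where
  "uses_client k x \<longleftrightarrow> k \<in># clients x"

definition uses_deleted_client :: "'x fdata \<Rightarrow> 'x fdata \<Rightarrow> ('p, 'x) iteration \<Rightarrow> bool" where
  "uses_deleted_client D D' = uses_client (the_elem (Domain (sym_diff D D')))"

text \<open>Rejection sampling is applied to the ordered draws, which are uniform on lists, whereas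
  the multisets are in general not uniform. Whether \<open>k\<close> occurs can be read off from
  either.\<close>

lemma resample_clients:
  fixes D D' :: "'x fdata"
  assumes "finite (Domain D)" "Domain D' = Domain D - {k}" "Domain D' \<noteq> {}"
  shows "bind_pmf (sample_clients p D) (\<lambda>P. if k \<in># P then sample_clients p D' else return_pmf P) =
    sample_clients p D'"
proof -
  let ?L = "\<lambda>D. {xs. set xs \<subseteq> Domain D \<and> length xs = cohort_size p}"
  have L: "finite (?L E)" "?L E \<noteq> {}" if E: "finite (Domain E)" "Domain E \<noteq> {}" for E :: "'x fdata"
  proof -
    obtain a where "a \<in> Domain E" using E by auto
    then have "replicate (cohort_size p) a \<in> ?L E" by (auto simp: set_replicate_conv_if)
    then show "?L E \<noteq> {}" by blast
    show "finite (?L E)" using finite_lists_length_eq[OF E(1)] .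
  qed
  have D: "Domain D \<noteq> {}" "finite (Domain D')" using assms by auto
  have sc: "sample_clients p E = map_pmf mset (pmf_of_set (?L E))"
    if E: "finite (Domain E)" "Domain E \<noteq> {}" for E :: "'x fdata"
    by (simp add: sample_clients_def replicate_pmf_of_set[OF E])
  have "bind_pmf (sample_clients p D) (\<lambda>P. if k \<in># P then sample_clients p D' else return_pmf P) =
      bind_pmf (pmf_of_set (?L D)) (\<lambda>xs. map_pmf mset (if xs \<in> ?L D' then return_pmf xs else pmf_of_set (?L D')))"
    unfolding sc[OF assms(1) D(1)] sc[OF D(2) assms(3)] bind_map_pmf
    using L[OF assms(1) D(1)] assms(2) by (intro bind_pmf_cong refl) auto
  also have "\<dots> = map_pmf mset (pmf_of_set (?L D'))"
    unfolding map_bind_pmf[symmetric]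
    by (subst resample_pmf_of_set) (use L[OF assms(1) D(1)] L[OF D(2) assms(3)] assms(2) in auto)
  finally show ?thesis using sc[OF D(2) assms(3)] by simp
qed

lemma fats_cu_untouched:
  assumes "untouched (uses_client k) s" "snd s \<noteq> []"
  shows "fats_cu p D' (length (snd s)) k s = return_pmf (False, s)"
proof -
  let ?E = "local_iters p" and ?L = "length (snd s)"
  have "k \<notin># clients (snd s ! ((r - 1) * ?E + 1 - 1))" if "r \<in> {1..<Suc ((?L - 1) div ?E + 1)}" for r
  proof -
    \<comment> \<open>The iterations inspected by the search lie inside the saved history.\<close>
    have "(r - 1) * ?E \<le> (?L - 1) div ?E * ?E" using that by (intro mult_right_mono) auto
    also have "\<dots> \<le> ?L - 1" by simp
    finally have "(r - 1) * ?E < ?L" using assms(2) by (cases "snd s") auto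
    then show ?thesis using assms(1) by (auto simp: untouched_def uses_client_def)
  qed
  then have "find (\<lambda>r. k \<in># clients (snd s ! ((r - 1) * ?E + 1 - 1))) [1..<Suc ((?L - 1) div ?E + 1)] = None"
    unfolding find_None_iff set_upt by blast
  then show ?thesis by (simp add: fats_cu_def)
qed

text \<open>A client that occurs in an iteration already occurs in the first iteration of its round.\<close>

lemma fats_cu_touched:
  assumes "0 < local_iters p" "0 < horizon p" "consistent p s" "snd s = h @ x # r"
    "\<forall>y\<in>set h. \<not> uses_client k y" "uses_client k x"
  shows "fats_cu p D' (length (snd s)) k s =
    map_pmf (Pair True) (bind_pmf (iterate p D' (latest_state p h)) (fats_train p D' (horizon p)))"
proof -
  let ?E = "local_iters p" and ?L = "length (snd s)"
  have "length h + 1 \<in> round_starts p"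
  proof (rule ccontr)
    assume start: "length h + 1 \<notin> round_starts p"
    then have "h \<noteq> []" using one_in_round_starts[of p] by auto
    moreover have "clients x = clients (last h)" using assms(3,4) start by (rule consistent_clients)
    ultimately show False using assms(5,6) by (auto simp: uses_client_def)
  qed
  then obtain m where m: "length h = m * ?E" "m \<le> (horizon p - 1) div ?E"
    by (auto simp: round_starts_def)
  \<comment> \<open>The round of \<open>x\<close> starts no later than the horizon, so a restart
    there performs at least one iteration and \<open>fats_train_step\<close> applies.\<close>
  have "m * ?E \<le> (horizon p - 1) div ?E * ?E" using m(2) by (rule mult_right_mono) simp
  also have "\<dots> \<le> horizon p - 1" by simp
  finally have len: "length (snd (latest_state p h)) < horizon p" using assms(2) m(1) by simp
  \<comment> \<open>\<open>m\<close> counts rounds from 0, the search from 1.\<close>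
  have "find (\<lambda>r. k \<in># clients (snd s ! ((r - 1) * ?E + 1 - 1))) [1..<Suc ((?L - 1) div ?E + 1)] = Some (m + 1)"
  proof (rule find_upt_eq_Some)
    show "k \<in># clients (snd s ! ((m + 1 - 1) * ?E + 1 - 1))"
      using assms(4,6) m(1)[symmetric] by (simp add: uses_client_def)
    have "m * ?E div ?E \<le> (?L - 1) div ?E"
      by (rule div_le_mono) (simp add: assms(4) m(1)[symmetric])
    then show "m + 1 < Suc ((?L - 1) div ?E + 1)" using assms(1) by simp
  next
    fix i assume "1 \<le> i" "i < m + 1"
    then have "(i - 1) * ?E < m * ?E" using assms(1) by (intro mult_strict_right_mono) auto
    then have "snd s ! ((i - 1) * ?E + 1 - 1) \<in> set h" using assms(4) m(1) by (simp add: nth_append)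
    with assms(5) show "k \<notin># clients (snd s ! ((i - 1) * ?E + 1 - 1))"
      by (auto simp: uses_client_def)
  qed simp
  then have "fats_cu p D' (length (snd s)) k s = map_pmf (Pair True) (fats p D' (length h + 1) s)"
    by (simp add: fats_cu_def m(1))
  also have "fats p D' (length h + 1) s =
      bind_pmf (iterate p D' (latest_state p h)) (fats_train p D' (horizon p))"
    unfolding fats_def rewind_latest_state[OF assms(4)] using len by (rule fats_train_step)
  finally show ?thesis .
qed

text \<open>A first bad record occurs only at a round start, where the whole client multiset is
  redrawn. For a multiset without \<open>k\<close>, the deletion does not affect the
  batches.\<close>

lemma resampling_unlearning_fats_cu:
  fixes p :: "('p::euclidean_space, 'x) fats_params"
  assumes "0 < local_iters p" "0 < horizon p" "D \<in> trainable p" "D' \<in> trainable p" "client_deletion D D'"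
  shows "resampling_unlearning p D D' (uses_deleted_client D D')
    (\<lambda>h x. iterate p D' (latest_state p h)) (fats_cu_request p D' (sym_diff D D'))"
proof -
  obtain k where k: "k \<in> Domain D" "Domain D' = Domain D - {k}" "\<forall>j. j \<noteq> k \<longrightarrow> D' `` {j} = D `` {j}"
    "D' \<subseteq> D" "Domain (sym_diff D D') = {k}"
    using assms(5) by (rule client_deletionE)
  have bad: "uses_deleted_client D D' = uses_client k"
    by (simp add: uses_deleted_client_def k(5))
  have cu: "fats_cu_request p D' (sym_diff D D') s = fats_cu p D' (length (snd s)) k s" for s
    by (simp add: fats_cu_request_def k(5))
  have fin: "finite (Domain D)" using assms(3) by (simp add: trainable_def finite_Domain)
  have ne: "Domain D' \<noteq> {}" using assms(4) by (auto simp: trainable_def)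
  have same: "iterate_with p D P s = iterate_with p D' P s" if "k \<notin># P" for P s
  proof -
    have "sample_batches p D P = sample_batches p D' P"
      by (rule sample_batches_cong) (metis k(3) that)
    then show ?thesis by (simp add: iterate_with_def)
  qed
  show ?thesis
    unfolding bad cu
  proof
    show "0 < horizon p" by fact
  next
    fix s :: "('p, 'x) fats_state" assume s: "consistent p s" and unt: "untouched (uses_client k) s"
    let ?redo = "\<lambda>s'. if uses_client k (last (snd s')) then iterate p D' s else return_pmf s'"
    have redo: "bind_pmf (iterate_with p D P s) ?redo =
        (if k \<in># P then iterate p D' s else iterate_with p D' P s)" for P
    proof -
      have "bind_pmf (iterate_with p D P s) ?redo = bind_pmf (iterate_with p D P s)
          (if k \<in># P then \<lambda>_. iterate p D' s else return_pmf)"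
        by (intro bind_pmf_cong refl) (auto simp: uses_client_def elim!: iterate_with_update)
      then show ?thesis by (simp add: bind_return_pmf' same)
    qed
    have "bind_pmf (iterate p D s) ?redo = iterate p D' s"
    proof (cases "length (snd s) + 1 \<in> round_starts p")
      case True
      have iter: "iterate p E s = bind_pmf (sample_clients p E) (\<lambda>P. iterate_with p E P s)" for E
        using True by (simp add: iterate_def)
      have "bind_pmf (iterate p D s) ?redo =
          bind_pmf (sample_clients p D) (\<lambda>P. if k \<in># P then iterate p D' s else iterate_with p D' P s)"
        by (simp add: iter[of D] bind_assoc_pmf redo)
      also have "\<dots> = bind_pmf (sample_clients p D) (\<lambda>P.
          bind_pmf (if k \<in># P then sample_clients p D' else return_pmf P) (\<lambda>P. iterate_with p D' P s))"
        by (intro bind_pmf_cong refl) (simp add: iter bind_return_pmf)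
      also have "\<dots> = iterate p D' s"
        by (simp add: bind_assoc_pmf[symmetric] resample_clients[OF fin k(2) ne] iter)
      finally show ?thesis .
    next
      case False
      then have "snd s \<noteq> []" using one_in_round_starts[of p] by auto
      \<comment> \<open>Inside a round the clients come from an untouched record, so no resampling
        takes place.\<close>
      then have "k \<notin># clients (last (snd s))" using unt by (auto simp: untouched_def uses_client_def)
      then show ?thesis using False redo[of "clients (last (snd s))"]
        by (simp add: iterate_def bind_return_pmf)
    qed
    then show "bind_pmf (iterate p D s) (\<lambda>s'. if uses_client k (last (snd s'))
          then iterate p D' (latest_state p (snd s)) else return_pmf s') = iterate p D' s"
      unfolding consistent_latest_state[OF s, symmetric] by simp
  next
    fix s s' :: "('p, 'x) fats_state" and h x r
    assume "consistent p s" "snd s = h @ x # r" "s' \<in> set_pmf (iterate p D' (latest_state p h))"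
    then show "consistent p s'" by (blast intro: consistent_iterate consistent_prefix)
  next
    fix s :: "('p, 'x) fats_state" assume "untouched (uses_client k) s" "snd s \<noteq> []"
    then show "fats_cu p D' (length (snd s)) k s = return_pmf (False, s)"
      by (rule fats_cu_untouched)
  next
    fix s :: "('p, 'x) fats_state" and h x r
    assume "consistent p s" "snd s = h @ x # r" "\<forall>y\<in>set h. \<not> uses_client k y" "uses_client k x"
    then show "fats_cu p D' (length (snd s)) k s =
      map_pmf (Pair True) (bind_pmf (iterate p D' (latest_state p h)) (fats_train p D' (horizon p)))"
      using assms(1,2) by (intro fats_cu_touched)
  qed
qed

section \<open>Probability of a re-computation\<close>

lemma prob_sample_clients_le:
  assumes "finite (Domain D)" "Domain D \<noteq> {}"
  shows "measure_pmf.prob (sample_clients p D) {P. k \<in># P} \<le> real (cohort_size p) / real (card (Domain D))"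
proof -
  have "mset -` {P. k \<in># P} = {xs. k \<in> set xs}" by auto
  then have "measure_pmf.prob (sample_clients p D) {P. k \<in># P} \<le>
      real (cohort_size p) * pmf (pmf_of_set (Domain D)) k"
    using prob_replicate_pmf_mem_le by (simp add: sample_clients_def)
  also have "\<dots> \<le> real (cohort_size p) * (1 / real (card (Domain D)))"
    using assms by (intro mult_left_mono) (auto simp: pmf_of_set indicator_def)
  finally show ?thesis by simp
qed

text \<open>Inside a round the cohort is inherited, so the previous record decides the event
  there.\<close>

lemma prob_iterate_uses_client_le:
  assumes "finite (Domain D)" "Domain D \<noteq> {}"
  shows "measure_pmf.prob (iterate p D s) {s'. uses_client k (last (snd s'))} \<le>
    (if length (snd s) + 1 \<in> round_starts p then real (cohort_size p) / real (card (Domain D))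
     else indicator {s. uses_client k (last (snd s))} s)"
proof -
  let ?Q = "if length (snd s) + 1 \<in> round_starts p then sample_clients p D
    else return_pmf (clients (last (snd s)))"
  have "measure_pmf.prob (iterate_with p D P s) {s'. uses_client k (last (snd s'))} \<le>
      1 * measure_pmf.prob (return_pmf P) {P. k \<in># P} + 0" for P
    by (cases "k \<in># P") (simp_all add: iterate_with_def uses_client_def)
  then have "measure_pmf.prob (iterate p D s) {s'. uses_client k (last (snd s'))} \<le>
      1 * measure_pmf.prob (bind_pmf ?Q return_pmf) {P. k \<in># P} + 0"
    unfolding iterate_def by (rule prob_bind_pmf_le)
  then show ?thesis
    using prob_sample_clients_le[OF assms, of p k]
    by (auto simp: bind_return_pmf' uses_client_def indicator_def split: if_splits)
qed

text \<open>Condition on the cohort: if \<open>k\<close> is present, its batch is uniform and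
  contains \<open>X\<close> with exactly this ratio; if \<open>k\<close> is absent, both events
  fail.\<close>

lemma prob_iterate_uses_sample_le:
  assumes "D \<in> trainable p" "(k, X) \<in> D" "0 < batch_size p"
  shows "measure_pmf.prob (iterate p D s) {s'. uses_sample k X (last (snd s'))} \<le>
    real (batch_size p) / real (card (D `` {k})) *
      measure_pmf.prob (iterate p D s) {s'. uses_client k (last (snd s'))}"
proof -
  let ?r = "real (batch_size p) / real (card (D `` {k}))"
  have "measure_pmf.prob (iterate_with p D P s) {s'. uses_sample k X (last (snd s'))} \<le>
      ?r * measure_pmf.prob (iterate_with p D P s) {s'. uses_client k (last (snd s'))} + 0" for P
  proof (cases "k \<in># P")
    case True
    have "measure_pmf.prob (sample_batches p D P) {B. X \<in> B k} =
        measure_pmf.prob (map_pmf (\<lambda>B. B k) (sample_batches p D P)) {B. X \<in> B}"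
      by simp
    also have "\<dots> = measure_pmf.prob (pmf_of_set {B. B \<subseteq> D `` {k} \<and> card B = batch_size p}) {B. X \<in> B}"
      unfolding sample_batches_def by (subst Pi_pmf_component) (use True in auto)
    also have "\<dots> = ?r"
      by (rule prob_subset_of_size_mem)
        (use assms in \<open>auto simp: trainable_def finite_Image_singleton\<close>)
    finally show ?thesis
      using True by (simp add: iterate_with_def uses_sample_def uses_client_def)
  qed (simp add: iterate_with_def uses_sample_def uses_client_def)
  then have "measure_pmf.prob (iterate p D s) {s'. uses_sample k X (last (snd s'))} \<le>
      ?r * measure_pmf.prob (iterate p D s) {s'. uses_client k (last (snd s'))} + 0"
    unfolding iterate_def by (rule prob_bind_pmf_le)
  then show ?thesis by simp
qed

text \<open>The bound arises at each round start and is carried through the round with the cohort.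
  \<open>Suc n\<close> makes \<open>last\<close> refer to an actual record.\<close>

lemma prob_train_uses_client_le:
  assumes "finite (Domain D)" "Domain D \<noteq> {}"
  shows "measure_pmf.prob (fats_train p D (Suc n) (init_state p)) {s. uses_client k (last (snd s))} \<le>
    real (cohort_size p) / real (card (Domain D))"
proof (induction n)
  case 0
  have "fats_train p D (Suc 0) (init_state p) = iterate p D (init_state p)"
    by (simp add: init_state_def fats_train_Suc fats_train_done bind_return_pmf)
  then show ?case
    using prob_iterate_uses_client_le[OF assms, of p "init_state p" k] one_in_round_starts[of p]
    by (simp add: init_state_def)
next
  case (Suc n)
  let ?\<mu> = "fats_train p D (Suc n) (init_state p)"
  let ?K = "real (cohort_size p) / real (card (Domain D))"
  let ?A = "{s. uses_client k (last (snd s))}"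
  have train: "fats_train p D (Suc (Suc n)) (init_state p) = bind_pmf ?\<mu> (iterate p D)"
    by (rule fats_train_Suc) (simp add: init_state_def)
  have len: "length (snd s) = Suc n" if "s \<in> set_pmf ?\<mu>" for s
    using length_fats_train[OF that] by (simp add: init_state_def)
  show ?case
  proof (cases "Suc (Suc n) \<in> round_starts p")
    case True
    have "measure_pmf.prob (bind_pmf ?\<mu> (iterate p D)) ?A \<le>
        0 * measure_pmf.prob (bind_pmf ?\<mu> return_pmf) ?A + ?K"
    proof (rule prob_bind_pmf_le)
      fix s assume "s \<in> set_pmf ?\<mu>"
      then show "measure_pmf.prob (iterate p D s) ?A \<le> 0 * measure_pmf.prob (return_pmf s) ?A + ?K"
        using prob_iterate_uses_client_le[OF assms, of p s k] True len by simp
    qed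
    then show ?thesis by (simp add: train)
  next
    case False
    have "measure_pmf.prob (bind_pmf ?\<mu> (iterate p D)) ?A \<le>
        1 * measure_pmf.prob (bind_pmf ?\<mu> return_pmf) ?A + 0"
    proof (rule prob_bind_pmf_le)
      fix s assume "s \<in> set_pmf ?\<mu>"
      then show "measure_pmf.prob (iterate p D s) ?A \<le> 1 * measure_pmf.prob (return_pmf s) ?A + 0"
        using prob_iterate_uses_client_le[OF assms, of p s k] False len by simp
    qed
    then show ?thesis using Suc by (simp add: train bind_return_pmf')
  qed
qed

text \<open>A union bound over iterations, as batches are drawn anew in each: every one contributes
  the bound for \<open>k\<close> being in the cohort times the chance that its batch contains
  \<open>X\<close>.\<close>

lemma prob_train_touched_sample_le:
  assumes "D \<in> trainable p" "(k, X) \<in> D" "0 < batch_size p"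
  shows "measure_pmf.prob (fats_train p D n (init_state p)) {s. \<not> untouched (uses_sample k X) s} \<le>
    real n * (real (batch_size p) / real (card (D `` {k})) *
      (real (cohort_size p) / real (card (Domain D))))"
proof (induction n)
  case 0
  show ?case by (simp add: fats_train_done init_state_def untouched_def)
next
  case (Suc n)
  let ?\<mu> = "\<lambda>n. fats_train p D n (init_state p)"
  let ?r = "real (batch_size p) / real (card (D `` {k}))"
  let ?K = "real (cohort_size p) / real (card (Domain D))"
  let ?A = "{s. \<not> untouched (uses_sample k X) s}"
  \<comment> \<open>Leaving out the newest record makes this event decided before the last
    iteration.\<close>
  let ?A' = "{s. \<exists>x\<in>set (butlast (snd s)). uses_sample k X x}"
  let ?B = "{s. uses_sample k X (last (snd s))}"
  have train: "?\<mu> (Suc n) = bind_pmf (?\<mu> n) (iterate p D)"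
    by (rule fats_train_Suc) (simp add: init_state_def)
  have dom: "finite (Domain D)" "Domain D \<noteq> {}"
    using assms by (auto simp: trainable_def finite_Domain)
  have "?A \<subseteq> ?A' \<union> ?B"
  proof
    fix s assume "s \<in> ?A"
    then show "s \<in> ?A' \<union> ?B"
      by (cases "snd s" rule: rev_cases) (auto simp: untouched_def)
  qed
  then have "measure_pmf.prob (?\<mu> (Suc n)) ?A \<le> measure_pmf.prob (?\<mu> (Suc n)) (?A' \<union> ?B)"
    by (intro measure_pmf.finite_measure_mono) auto
  also have "\<dots> \<le> measure_pmf.prob (?\<mu> (Suc n)) ?A' + measure_pmf.prob (?\<mu> (Suc n)) ?B"
    by (rule measure_Un_le) auto
  also have "measure_pmf.prob (?\<mu> (Suc n)) ?A' \<le> 1 * measure_pmf.prob (bind_pmf (?\<mu> n) return_pmf) ?A + 0"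
    unfolding train
  proof (rule prob_bind_pmf_le)
    fix s
    show "measure_pmf.prob (iterate p D s) ?A' \<le> 1 * measure_pmf.prob (return_pmf s) ?A + 0"
    proof (cases "untouched (uses_sample k X) s")
      case True
      have "s' \<notin> ?A'" if "s' \<in> set_pmf (iterate p D s)" for s'
      proof -
        have "butlast (snd s') = snd s" using iterate_append[OF that] by (metis butlast_snoc)
        with True show ?thesis by (auto simp: untouched_def)
      qed
      then have "measure_pmf.prob (iterate p D s) ?A' = 0"
        by (subst measure_pmf_zero_iff) blast
      then show ?thesis by simp
    qed (simp add: measure_pmf.prob_le_1)
  qed
  also have "measure_pmf.prob (?\<mu> (Suc n)) ?B \<le>
      ?r * measure_pmf.prob (?\<mu> (Suc n)) {s. uses_client k (last (snd s))} + 0"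
    unfolding train using prob_iterate_uses_sample_le[OF assms] by (intro prob_bind_pmf_le) simp
  also have "\<dots> \<le> ?r * ?K + 0"
    using prob_train_uses_client_le[OF dom] by (intro add_right_mono mult_left_mono) auto
  finally show ?case using Suc by (simp add: bind_return_pmf' distrib_right add_divide_distrib)
qed

text \<open>Only the first iteration of a round can bring \<open>k\<close> in, so rounds rather than
  iterations are counted.\<close>

lemma prob_train_touched_client_le:
  assumes "finite (Domain D)" "Domain D \<noteq> {}"
  shows "measure_pmf.prob (fats_train p D n (init_state p)) {s. \<not> untouched (uses_client k) s} \<le>
    real (card (round_starts p \<inter> {1..n})) * (real (cohort_size p) / real (card (Domain D)))"
proof (induction n)
  case 0
  show ?case by (simp add: fats_train_done init_state_def untouched_def)
next
  case (Suc n)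
  let ?\<mu> = "fats_train p D n (init_state p)"
  let ?e = "if Suc n \<in> round_starts p then real (cohort_size p) / real (card (Domain D)) else 0"
  let ?A = "{s. \<not> untouched (uses_client k) s}"
  have train: "fats_train p D (Suc n) (init_state p) = bind_pmf ?\<mu> (iterate p D)"
    by (rule fats_train_Suc) (simp add: init_state_def)
  have "measure_pmf.prob (bind_pmf ?\<mu> (iterate p D)) ?A \<le>
      1 * measure_pmf.prob (bind_pmf ?\<mu> return_pmf) ?A + ?e"
  proof (rule prob_bind_pmf_le)
    fix s assume s: "s \<in> set_pmf ?\<mu>"
    have len: "length (snd s) = n" using length_fats_train[OF s] by (simp add: init_state_def)
    show "measure_pmf.prob (iterate p D s) ?A \<le> 1 * measure_pmf.prob (return_pmf s) ?A + ?e"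
    proof (cases "untouched (uses_client k) s")
      case True
      have "measure_pmf.prob (iterate p D s) ?A \<le>
          measure_pmf.prob (iterate p D s) {s'. uses_client k (last (snd s'))}"
        using True by (intro measure_pmf.finite_measure_mono_AE)
          (auto simp: AE_measure_pmf_iff untouched_iterate)
      also have "\<dots> \<le> ?e"
      proof (cases "Suc n \<in> round_starts p")
        case False
        then have "snd s \<noteq> []" using one_in_round_starts[of p] len by auto
        then have "\<not> uses_client k (last (snd s))" using True by (auto simp: untouched_def)
        then show ?thesis using False len prob_iterate_uses_client_le[OF assms, of p s k] by simp
      qed (use len prob_iterate_uses_client_le[OF assms, of p s k] in simp)
      finally show ?thesis using True by simp
    next
      case False
      have "measure_pmf.prob (iterate p D s) ?A \<le> 1 + ?e"
        by (rule order_trans[OF measure_pmf.prob_le_1]) simp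
      then show ?thesis using False by simp
    qed
  qed
  moreover have "round_starts p \<inter> {1..Suc n} =
      (if Suc n \<in> round_starts p then insert (Suc n) (round_starts p \<inter> {1..n}) else round_starts p \<inter> {1..n})"
    by (auto simp: le_Suc_eq)
  ultimately show ?case
    using Suc by (auto simp: train bind_return_pmf' algebra_simps add_divide_distrib split: if_splits)
qed

section \<open>The number of rounds and the data of the theorem\<close>

lemma card_round_starts_le:
  assumes "0 < local_iters p" "0 < R" "horizon p = R * local_iters p"
  shows "card (round_starts p \<inter> A) \<le> R"
proof -
  have "(horizon p - 1) div local_iters p < R"
    using assms by (intro less_mult_imp_div_less) simp
  then have "round_starts p \<subseteq> (\<lambda>s. s * local_iters p + 1) ` {..<R}"
    by (auto simp: round_starts_def)
  then have "card (round_starts p \<inter> A) \<le> card ((\<lambda>s. s * local_iters p + 1) ` {..<R})"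
    by (intro card_mono) auto
  also have "\<dots> \<le> R" by (metis card_image_le card_lessThan finite_lessThan)
  finally show ?thesis .
qed

text \<open>Feasibility of the batch size is read off from the data left by a request: some client
  \<open>j\<close> still has \<open>batch_size p\<close> samples, and it held \<open>N\<close>
  originally.\<close>

lemma Sigma_trainable:
  assumes data: "\<forall>k\<in>{1..M}. finite (\<D> k) \<and> card (\<D> k) = N"
    and sizes: "1 \<le> M" "1 \<le> N"
    and sub: "D' \<in> trainable p" "D' \<subseteq> Sigma {1..M} \<D>"
  shows "Sigma {1..M} \<D> \<in> trainable p"
    and "card (Domain (Sigma {1..M} \<D>)) = M"
    and "\<forall>k\<in>{1..M}. card (Sigma {1..M} \<D> `` {k}) = N"
proof -
  have img: "Sigma {1..M} \<D> `` {k} = \<D> k" if "k \<in> {1..M}" for k using that by auto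
  have ne: "\<D> k \<noteq> {}" if "k \<in> {1..M}" for k using bspec[OF data that] sizes by auto
  have dom: "Domain (Sigma {1..M} \<D>) = {1..M}" using ne by (fastforce simp: Domain_iff)
  show "card (Domain (Sigma {1..M} \<D>)) = M" unfolding dom by simp
  show "\<forall>k\<in>{1..M}. card (Sigma {1..M} \<D> `` {k}) = N" using img data by simp
  obtain j where j: "j \<in> Domain D'" using sub by (auto simp: trainable_def)
  then have "j \<in> {1..M}" using sub by auto
  have "batch_size p \<le> card (D' `` {j})" using j sub by (auto simp: trainable_def)
  also have "\<dots> \<le> card (\<D> j)" using sub bspec[OF data \<open>j \<in> {1..M}\<close>] by (intro card_mono) auto
  finally have b: "batch_size p \<le> N" using bspec[OF data \<open>j \<in> {1..M}\<close>] by simp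
  have "1 \<in> Domain (Sigma {1..M} \<D>)" unfolding dom using sizes by simp
  then have "Sigma {1..M} \<D> \<noteq> {}" by (metis Domain_empty empty_iff)
  then show "Sigma {1..M} \<D> \<in> trainable p"
    using data b dom img by (auto simp: trainable_def)
qed

lemma recomputation_prob_Nil: "recomputation_prob T s train unlearn D [] = 0"
proof -
  have "Pair False -` {(c, s). c} = {}" by auto
  then show ?thesis by (simp add: recomputation_prob_def)
qed

theorem theorem1:
  fixes p :: "('p::euclidean_space, 'x) fats_params"
    and \<D> :: "nat \<Rightarrow> 'x set"
    and M N R :: nat
    and \<rho>\<^sub>S \<rho>\<^sub>C :: real
  assumes rho_S: "0 < \<rho>\<^sub>S" "\<rho>\<^sub>S \<le> 1"
    and rho_C: "0 < \<rho>\<^sub>C" "\<rho>\<^sub>C \<le> 1"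
    and sizes: "1 \<le> M" "1 \<le> N" "1 \<le> R" "1 \<le> local_iters p"
    and data: "\<And>k. k \<in> {1..M} \<Longrightarrow> finite (\<D> k) \<and> card (\<D> k) = N"
    and differentiable: "\<And>\<theta> X. (\<lambda>\<theta>'. loss p \<theta>' X) differentiable (at \<theta>)"
    and horizon: "horizon p = R * local_iters p"
    and K: "0 < cohort_size p"
           "real (cohort_size p) = \<rho>\<^sub>C * real (local_iters p) * real M / real (horizon p)"
    and b: "0 < batch_size p"
           "real (batch_size p) = \<rho>\<^sub>S * real N / (\<rho>\<^sub>C * real (local_iters p))"
  shows "sample_level_exact_unlearning (trainable p) (horizon p) (init_state p)
           (fats_train p) (fats_su p) \<and>
         client_level_exact_unlearning (trainable p) (horizon p) (init_state p)
           (fats_train p) (fats_cu_request p) \<and>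
         (\<forall>w rs. length rs = w \<and>
            request_sequence sample_deletion (trainable p) (horizon p) (Sigma {1..M} \<D>) rs \<longrightarrow>
            recomputation_prob (horizon p) (init_state p) (fats_train p) (fats_su p)
              (Sigma {1..M} \<D>) rs \<le> \<rho>\<^sub>S * real w \<and>
            recomputation_prob (horizon p) (init_state p) (fats_train p) (fats_su_redraw p)
              (Sigma {1..M} \<D>) rs \<le> \<rho>\<^sub>S * real w) \<and>
         (\<forall>w rs. length rs = w \<and>
            request_sequence client_deletion (trainable p) (horizon p) (Sigma {1..M} \<D>) rs \<longrightarrow>
            recomputation_prob (horizon p) (init_state p) (fats_train p) (fats_cu_request p)
              (Sigma {1..M} \<D>) rs \<le> \<rho>\<^sub>C * real w)"
proof -
  let ?T = "horizon p" and ?E = "local_iters p" and ?D = "Sigma {1..M} \<D>"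
  let ?batch_rate = "real (batch_size p) / real N" and ?cohort_rate = "real (cohort_size p) / real M"
  have E: "0 < ?E" and T: "0 < ?T" using sizes horizon by auto
  have data': "\<forall>k\<in>{1..M}. finite (\<D> k) \<and> card (\<D> k) = N" using data by blast
  note su = resampling_unlearning_fats_su[OF T]
  note cu = resampling_unlearning_fats_cu[OF E T]
  have T_eq: "real ?T = real R * real ?E" using horizon by simp
  \<comment> \<open>b / N = \<open>\<rho>\<^sub>S\<close> / (\<open>\<rho>\<^sub>C\<close> * E) and
    K / M = \<open>\<rho>\<^sub>C\<close> * E / T, so that T, E and \<open>\<rho>\<^sub>C\<close>
    cancel.\<close>
  have rate_S: "real ?T * (?batch_rate * ?cohort_rate) = \<rho>\<^sub>S"
    using sizes rho_C E unfolding b(2) K(2) T_eq by (simp add: field_simps)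
  \<comment> \<open>K / M = \<open>\<rho>\<^sub>C\<close> / R, as T = R * E.\<close>
  have rate_C: "real R * ?cohort_rate = \<rho>\<^sub>C"
    using sizes E unfolding K(2) T_eq by (simp add: field_simps)
  have sample: "recomputation_prob ?T (init_state p) (fats_train p) (fats_su p) ?D rs \<le> \<rho>\<^sub>S * real (length rs) \<and>
      recomputation_prob ?T (init_state p) (fats_train p) (fats_su_redraw p) ?D rs \<le> \<rho>\<^sub>S * real (length rs)"
    if rs: "request_sequence sample_deletion (trainable p) ?T ?D rs" for rs
  \<comment> \<open>Without requests nothing is re-computed; a first request shows that the original
    data are trainable.\<close>
  proof (cases rs)
    case Nil
    then show ?thesis by (simp add: recomputation_prob_Nil)
  next
    case (Cons request rs')
    obtain t D' where "request = (t, D')" by (cases request)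
    then have "sample_deletion ?D D'" "D' \<in> trainable p"
      using rs Cons by (blast dest: request_sequence_Cons)+
    then have "D' \<in> trainable p" "D' \<subseteq> ?D" by (auto simp: sample_deletion_def)
    note D = Sigma_trainable[OF data' sizes(1,2) this]
    \<comment> \<open>The run is on the original data, whose local datasets all have size
      \<open>N\<close>, while \<open>D1\<close> stands for what earlier requests have left.\<close>
    have bound: "D2 \<subseteq> D1 \<and> measure_pmf.prob (fats_train p ?D ?T (init_state p))
        {s. \<not> untouched (uses_deleted_sample D1 D2) s} \<le> \<rho>\<^sub>S"
      if sub: "D1 \<subseteq> ?D" and deletion: "sample_deletion D1 D2" for D1 D2
    proof -
      obtain k X where del: "sym_diff D1 D2 = {(k, X)}" "(k, X) \<in> D1" "D2 = D1 - {(k, X)}"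
        using deletion by (rule sample_deletionE)
      have kX: "(k, X) \<in> ?D" using del sub by auto
      then have "k \<in> {1..M}" by auto
      have "measure_pmf.prob (fats_train p ?D ?T (init_state p)) {s. \<not> untouched (uses_sample k X) s} \<le> \<rho>\<^sub>S"
        using prob_train_touched_sample_le[OF D(1) kX b(1), of ?T]
        unfolding D(2) bspec[OF D(3) \<open>k \<in> {1..M}\<close>] rate_S .
      moreover have "D2 \<subseteq> D1" using del(3) by blast
      ultimately show ?thesis unfolding uses_deleted_sample_def del(1) by simp
    qed
    note le = recomputation_prob_le[where \<A> = "trainable p" and bad = uses_deleted_sample, OF su rs D(1)]
    show ?thesis
    proof
      show "recomputation_prob ?T (init_state p) (fats_train p) (fats_su p) ?D rs \<le> \<rho>\<^sub>S * real (length rs)"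
        by (rule le) (assumption | rule fats_su_untouched bound)+
      show "recomputation_prob ?T (init_state p) (fats_train p) (fats_su_redraw p) ?D rs \<le> \<rho>\<^sub>S * real (length rs)"
        by (rule le) (assumption | rule fats_su_untouched bound)+
    qed
  qed
  have client: "recomputation_prob ?T (init_state p) (fats_train p) (fats_cu_request p) ?D rs \<le> \<rho>\<^sub>C * real (length rs)"
    if rs: "request_sequence client_deletion (trainable p) ?T ?D rs" for rs
  proof (cases rs)
    case Nil
    then show ?thesis by (simp add: recomputation_prob_Nil)
  next
    case (Cons request rs')
    obtain t D' where "request = (t, D')" by (cases request)
    then have "client_deletion ?D D'" "D' \<in> trainable p"
      using rs Cons by (blast dest: request_sequence_Cons)+
    then have "D' \<in> trainable p" "D' \<subseteq> ?D" by (auto simp: client_deletion_def)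
    note D = Sigma_trainable[OF data' sizes(1,2) this]
    have dom: "finite (Domain ?D)" "Domain ?D \<noteq> {}"
      using D(1) by (auto simp: trainable_def finite_Domain)
    have bound: "D2 \<subseteq> D1 \<and> measure_pmf.prob (fats_train p ?D ?T (init_state p))
        {s. \<not> untouched (uses_deleted_client D1 D2) s} \<le> \<rho>\<^sub>C"
      if "client_deletion D1 D2" for D1 D2
    proof -
      have "D2 \<subseteq> D1" using that by (auto simp: client_deletion_def)
      let ?k = "the_elem (Domain (sym_diff D1 D2))"
      have "measure_pmf.prob (fats_train p ?D ?T (init_state p)) {s. \<not> untouched (uses_client ?k) s} \<le>
          real (card (round_starts p \<inter> {1..?T})) * ?cohort_rate"
        using prob_train_touched_client_le[OF dom] unfolding D(2) .
      also have "\<dots> \<le> real R * ?cohort_rate"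
        using card_round_starts_le[OF E _ horizon] sizes by (intro mult_right_mono) auto
      finally show ?thesis using \<open>D2 \<subseteq> D1\<close> rate_C by (simp add: uses_deleted_client_def)
    qed
    have unchanged: "fats_cu_request p D2 (sym_diff D1 D2) s = return_pmf (False, s)"
      if "D1 \<in> trainable p" "D2 \<in> trainable p" "client_deletion D1 D2"
        "untouched (uses_deleted_client D1 D2) s" "snd s \<noteq> []" for D1 D2 s
      using resampling_unlearning.unlearn_untouched[OF cu] that by blast
    show ?thesis
      by (rule recomputation_prob_le[where \<A> = "trainable p" and bad = uses_deleted_client, OF cu rs D(1)])
        (assumption | rule unchanged bound)+
  qed
  have "exact_unlearning sample_deletion (trainable p) ?T (init_state p) (fats_train p) (fats_su p)"
    by (rule exact_unlearning_fats) (rule su)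
  moreover have "exact_unlearning client_deletion (trainable p) ?T (init_state p) (fats_train p) (fats_cu_request p)"
    by (rule exact_unlearning_fats) (rule cu)
  ultimately show ?thesis using sample client by blast
qed

end
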